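(* Let $a(z),b(z)$ be complex polynomials of degree four and eight respectively, let $D=a^2-4b$, assume $b$ and $D$ are not identically zero, and consider the family of curves $E_z: y^2=x\left(x^2+a(z)x+b(z)\right)$, which are elliptic curves for $z$ with $b(z)D(z)\neq0$. For such $z$, let $(\omega_1,\omega_2)$ be an admissible period basis of $E_z$ and $\tau=\omega_2/\omega_1$. Then $$\frac{\eta(2\tau)^{24}}{\eta(\tau)^{24}}=\frac{D(z)}{2^8\,b(z)},\qquad \frac{\eta(2\tau)^{8}}{\eta(\tau)^{16}}=\left(\frac{2\pi}{\omega_1}\right)^4\frac{1}{b(z)}.$$ Moreover, for every positively oriented simple closed loop $\gamma$ in the $z$-plane avoiding the zeros of $bD$, the monodromy $\mathsf{M}_\gamma$ lies in $\Gamma_0(2)$ and its charges are $$\mathcal{Q}^{\mathbb{Z}}(\mathsf{M}_\gamma)=\sum_{z_*}\left(\operatorname{ord}_{z=z_*}D(z)-\operatorname{ord}_{z=z_*}b(z)\right)\in\mathbb{Z},\qquad \mathcal{Q}^{\mathbb{Z}_4}(\mathsf{M}_\gamma)=-\sum_{z_*}\operatorname{ord}_{z=z_*}b(z)\in\mathbb{Z}_4,$$ where the sums run over the zeros $z_*$ of $bD$ inside $\gamma$.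
   Context: $\eta$ is the Dedekind eta function. $\Gamma_0(2)\subset\mathrm{SL}(2,\mathbb{Z})$ is the subgroup of matrices with even lower-left entry; it is generated by $\mathsf{T}=\begin{pmatrix}1&1\\0&1\end{pmatrix}$ and $\mathsf{X}=\begin{pmatrix}1&-1\\2&-1\end{pmatrix}$. $\mathcal{Q}^{\mathbb{Z}}:\Gamma_0(2)\to\mathbb{Z}$ and $\mathcal{Q}^{\mathbb{Z}_4}:\Gamma_0(2)\to\mathbb{Z}_4$ are the group homomorphisms determined by $\mathcal{Q}^{\mathbb{Z}}(\mathsf{T})=1$, $\mathcal{Q}^{\mathbb{Z}}(\mathsf{X})=0$, $\mathcal{Q}^{\mathbb{Z}_4}(\mathsf{T})=0$, $\mathcal{Q}^{\mathbb{Z}_4}(\mathsf{X})=1$. Admissible period basis: for $b(z)D(z)\ne0$ let $\Lambda_z\subset\mathbb{C}$ be the lattice of periods of the holomorphic 1-form $dx/y$ on $E_z$, so $E_z\cong\mathbb{C}/\Lambda_z$ with the point at infinity corresponding to $0$. A $\mathbb{Z}$-basis $(\omega_1,\omega_2)$ of $\Lambda_z$ is admissible if $\operatorname{Im}(\omega_2/\omega_1)>0$ and the point $\omega_1/2$ corresponds to the distinguished 2-torsion point $(x,y)=(0,0)$. Monodromy: continuing an admissible basis continuously along $\gamma$ takes $(\omega_2,\omega_1)$ to $(p\omega_2+q\omega_1, r\omega_2+s\omega_1)$; the monodromy is $\mathsf{M}_\gamma=\begin{pmatrix}p&q\\ r&s\end{pmatrix}$, so that $\tau\mapsto\mathsf{M}_\gamma\cdot\tau$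 and $\omega_1\mapsto(r\tau+s)\omega_1$. It is defined up to conjugation in $\Gamma_0(2)$ (change of admissible basis), which does not affect the charges. *)

theory Defs
  imports "HOL-Complex_Analysis.Complex_Analysis" "HOL-Algebra.Elementary_Groups"
begin

section \<open>The Dedekind eta function\<close>

definition dedekind_eta :: "complex \<Rightarrow> complex" where
  "dedekind_eta \<tau> =
     exp (2 * of_real pi * \<i> * \<tau> / 24) *
     (\<Prod>n. 1 - exp (2 * of_real pi * \<i> * of_nat (Suc n) * \<tau>))"


section \<open>The group $\Gamma_0(2)$\<close>

definition Gamma0_2 :: "(int ^ 2 ^ 2) monoid" where
  "Gamma0_2 = \<lparr>carrier = {M. det M = 1 \<and> even (M $ 2 $ 1)}, mult = (**), one = mat 1\<rparr>"

definition mat_T :: "int ^ 2 ^ 2" where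
  "mat_T = vector [vector [1, 1], vector [0, 1]]"

definition mat_X :: "int ^ 2 ^ 2" where
  "mat_X = vector [vector [1, -1], vector [2, -1]]"


section \<open>The curve $y^2 = x(x^2 + ax + b)$ and its periods\<close>

definition affine_curve :: "complex \<Rightarrow> complex \<Rightarrow> (complex \<times> complex) set" where
  "affine_curve a b = {(x, y). y\<^sup>2 = x * (x\<^sup>2 + a * x + b)}"

text \<open>
  The value of the 1-form $dx/y$ at the point $(x,y)$ on the tangent vector $(u,v)$. Differentiating
  the equation gives $2y\,dy = (3x^2 + 2ax + b)\,dx$, which extends the form to the points
  with $y = 0$.
\<close>

definition dx_over_y ::
  "complex \<Rightarrow> complex \<Rightarrow> complex \<times> complex \<Rightarrow> complex \<times> complex \<Rightarrow> complex" where
  "dx_over_y a b = (\<lambda>(x, y) (u, v).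
     if y \<noteq> 0 then u / y else 2 * v / (3 * x\<^sup>2 + 2 * a * x + b))"

text \<open>
  Loops are taken on the affine part of the curve. As the form is holomorphic at the point at
  infinity, and loops can be deformed away from that point, this gives all periods.
\<close>

definition period_lattice :: "complex \<Rightarrow> complex \<Rightarrow> complex set" where
  "period_lattice a b =
     {integral {0..1} (\<lambda>t. dx_over_y a b (c t) (vector_derivative c (at t within {0..1}))) | c.
        valid_path c \<and> pathfinish c = pathstart c \<and> path_image c \<subseteq> affine_curve a b}"

text \<open>
  The isomorphism from $\mathbb{C}/\Lambda$ to the curve, as a $\Lambda$-periodic map on the plane
  that sends $\Lambda$ to the point at infinity and the rest bijectively (modulo $\Lambda$) to the
  affine part. Pulling $dx/y$ back to $dw$ makes it unique: without this condition it would only be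
  determined up to the automorphisms of the curve, which may permute the 2-torsion points.
\<close>

definition uniformization ::
  "complex \<Rightarrow> complex \<Rightarrow> (complex \<Rightarrow> complex \<times> complex) \<Rightarrow> bool" where
  "uniformization a b \<phi> \<longleftrightarrow>
     (fst \<circ> \<phi>) holomorphic_on - period_lattice a b \<and>
     (snd \<circ> \<phi>) holomorphic_on - period_lattice a b \<and>
     (\<forall>l\<in>period_lattice a b. is_pole (fst \<circ> \<phi>) l) \<and>
     \<phi> ` (- period_lattice a b) = affine_curve a b \<and>
     (\<forall>w\<in>- period_lattice a b. \<forall>w'\<in>- period_lattice a b.
        \<phi> w = \<phi> w' \<longleftrightarrow> w - w' \<in> period_lattice a b) \<and>
     (\<forall>w\<in>- period_lattice a b.
        dx_over_y a b (\<phi> w) (deriv (fst \<circ> \<phi>) w, deriv (snd \<circ> \<phi>) w) = 1)"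

definition admissible_basis :: "complex \<Rightarrow> complex \<Rightarrow> complex \<Rightarrow> complex \<Rightarrow> bool" where
  "admissible_basis a b \<omega>\<^sub>1 \<omega>\<^sub>2 \<longleftrightarrow>
     period_lattice a b = {of_int m * \<omega>\<^sub>1 + of_int n * \<omega>\<^sub>2 | m n. True} \<and>
     Im (\<omega>\<^sub>2 / \<omega>\<^sub>1) > 0 \<and>
     (\<exists>\<phi>. uniformization a b \<phi> \<and> \<phi> (\<omega>\<^sub>1 / 2) = (0, 0))"


section \<open>Loops and monodromy\<close>

definition positive_simple_loop :: "(real \<Rightarrow> complex) \<Rightarrow> bool" where
  "positive_simple_loop \<gamma> \<longleftrightarrow>
     simple_path \<gamma> \<and> pathfinish \<gamma> = pathstart \<gamma> \<and>
     (\<forall>w\<in>inside (path_image \<gamma>). winding_number \<gamma> w = 1)"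

definition continued_basis ::
  "complex poly \<Rightarrow> complex poly \<Rightarrow> (real \<Rightarrow> complex) \<Rightarrow>
   (real \<Rightarrow> complex) \<Rightarrow> (real \<Rightarrow> complex) \<Rightarrow> bool" where
  "continued_basis a b \<gamma> \<omega>\<^sub>1 \<omega>\<^sub>2 \<longleftrightarrow>
     continuous_on {0..1} \<omega>\<^sub>1 \<and> continuous_on {0..1} \<omega>\<^sub>2 \<and>
     (\<forall>t\<in>{0..1}. admissible_basis (poly a (\<gamma> t)) (poly b (\<gamma> t)) (\<omega>\<^sub>1 t) (\<omega>\<^sub>2 t))"

definition monodromy_matrix ::
  "(real \<Rightarrow> complex) \<Rightarrow> (real \<Rightarrow> complex) \<Rightarrow> int ^ 2 ^ 2 \<Rightarrow> bool" where
  "monodromy_matrix \<omega>\<^sub>1 \<omega>\<^sub>2 M \<longleftrightarrow>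
     \<omega>\<^sub>2 1 = of_int (M $ 1 $ 1) * \<omega>\<^sub>2 0 + of_int (M $ 1 $ 2) * \<omega>\<^sub>1 0 \<and>
     \<omega>\<^sub>1 1 = of_int (M $ 2 $ 1) * \<omega>\<^sub>2 0 + of_int (M $ 2 $ 2) * \<omega>\<^sub>1 0"

end

(*
  For a basis (w1, w2) of the period lattice, the coordinate x of the uniformized curve is the
  elliptic function with principal part 4/w^2 at 0 and a double zero at w1/2.  By Liouville's
  theorem it equals an explicit quotient of q-products, from which b = x(w) x(w + w1/2) and
  a^2 - 4b, the squared difference of x at the two other half periods, are read off as
  q-products; these are the two eta quotients.

  The same uniqueness makes the quotients modular forms for X, of weight 0 and -4.  On the upper
  half plane they have logarithms; comparing these at the fixed point (1 + i)/2 of X shows that the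
  charges are exactly the defects of the logarithm of the first quotient and of the fourth root of
  the second one.  Along a loop, the first quotient is D/(256 b) and w1^4 times the second one is
  (2 pi)^4/b, so the defects are counted by the winding numbers of D and b.
*)

theory Submission
  imports Defs "HOL-Computational_Algebra.Fundamental_Theorem_Algebra"
begin

section \<open>q-products\<close>

text \<open>Since dx/y pulls back to dw, the coordinate x satisfies x'^2 = x (x^2 + a x + b), and
  this forces the leading coefficient 4 at its pole. Admissibility supplies a uniformization, so x
  has to be identified rather than constructed: the pole at 0 and the double zero at the marked half
  period determine it. The quotients depend only on the lattice and on the class of w1/2. The matrix
  X preserves both, because (2 w2 - w1)/2 = w1/2 + (w2 - w1), and so their behaviour under X follows
  without the inversion formula of eta. Taking a fourth root leaves a fourth root of unity
  undetermined; at the fixed point of X the automorphy factor 2 tau - 1 equals i, and this is the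
  source of the values in Z_4. Along a loop, admissibility provides a uniformization for each time
  separately, with no relation between them. At times 0 and 1 the curve is the same but the two
  uniformizations may differ a priori; that they send the same class of half periods to (0,0) has to
  be proved, and it is what makes the lower left entry of the monodromy even.\<close>

lemma holomorphic_prodinf:
  fixes f :: "nat \<Rightarrow> complex \<Rightarrow> complex"
  assumes A: "open A" and hol: "\<And>n. f n holomorphic_on A"
    and bound: "\<And>z. z \<in> A \<Longrightarrow> \<exists>d M. 0 < d \<and> cball z d \<subseteq> A \<and> summable M \<and>
                  (\<forall>n. \<forall>x\<in>cball z d. norm (f n x - 1) \<le> M n)"
  shows "(\<lambda>z. \<Prod>n. f n z) holomorphic_on A"
proof -
  have 1: "(\<lambda>z. \<Prod>n<N. f n z) holomorphic_on A" for N
    using hol by (simp add: holomorphic_on_prod)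
  have 2: "\<exists>d>0. cball z d \<subseteq> A \<and>
      uniform_limit (cball z d) (\<lambda>N x. \<Prod>n<N. f n x) (\<lambda>x. \<Prod>n. f n x) sequentially" if zA: "z \<in> A" for z
  proof -
    obtain d M where dM: "0 < d \<and> cball z d \<subseteq> A \<and> summable M \<and>
                    (\<forall>n. \<forall>x\<in>cball z d. norm (f n x - 1) \<le> M n)"
      using bound[OF zA] by (elim exE)
    have d: "0 < d" "cball z d \<subseteq> A" and M: "summable M"
      and le: "\<And>n x. x \<in> cball z d \<Longrightarrow> norm (f n x - 1) \<le> M n"
      using dM by auto
    have cont: "continuous_on (cball z d) (f n)" for n
      using hol d(2) holomorphic_on_imp_continuous_on holomorphic_on_subset by blast
    have conv: "convergent_prod (\<lambda>n. f n x)" if "x \<in> cball z d" for x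
    proof -
      have "summable (\<lambda>n. norm (f n x - 1))"
        by (rule summable_comparison_test[OF _ M]) (use le that in auto)
      then show ?thesis
        using abs_convergent_prod_conv_summable abs_convergent_prod_imp_convergent_prod by blast
    qed
    \<comment> \<open>The M-test controls the sums of |f n - 1|; uniform convergence passes from
      them to the partial products, even where single factors vanish.\<close>
    have "uniformly_convergent_on (cball z d) (\<lambda>N x. \<Prod>n<N. f n x)"
    proof (rule uniformly_convergent_on_prod'[OF cont])
      show "uniformly_convergent_on (cball z d) (\<lambda>N x. \<Sum>n<N. norm (f n x - 1))"
        by (rule Weierstrass_m_test'[OF _ M]) (use le in auto)
    qed auto
    then have "uniform_limit (cball z d) (\<lambda>N x. \<Prod>n<N. f n x) (\<lambda>x. lim (\<lambda>N. \<Prod>n<N. f n x)) sequentially"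
      using uniformly_convergent_uniform_limit_iff by blast
    moreover have "lim (\<lambda>N. \<Prod>n<N. f n x) = (\<Prod>n. f n x)" if "x \<in> cball z d" for x
      using convergent_prod_LIMSEQ[OF conv[OF that]] LIMSEQ_lessThan_iff_atMost limI by blast
    ultimately have "uniform_limit (cball z d) (\<lambda>N x. \<Prod>n<N. f n x) (\<lambda>x. \<Prod>n. f n x) sequentially"
      by (metis (mono_tags, lifting) uniform_limit_cong')
    with d show ?thesis
      by blast
  qed
  show ?thesis
    by (rule holomorphic_uniform_sequence[of A "\<lambda>N z. \<Prod>n<N. f n z" "\<lambda>z. \<Prod>n. f n z", OF A 1 2])
qed

text \<open>The q-Pochhammer symbol (z; q)_infinity. All eta and theta values below are expressed
  through it.\<close>

definition qpoch :: "complex \<Rightarrow> complex \<Rightarrow> complex" where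
  "qpoch q z = (\<Prod>n. 1 - z * q ^ n)"

context
  fixes q :: complex
  assumes q: "norm q < 1"
begin

lemma convergent_prod_qpoch: "convergent_prod (\<lambda>n. 1 - z * q ^ n)"
proof -
  have "summable (\<lambda>n. norm z * norm q ^ n)"
    by (intro summable_mult summable_geometric) (use q in auto)
  then have "summable (\<lambda>n. norm ((1 - z * q ^ n) - 1))"
    by (simp add: norm_mult norm_power)
  then show ?thesis
    using abs_convergent_prod_conv_summable abs_convergent_prod_imp_convergent_prod by blast
qed

lemma has_prod_qpoch: "(\<lambda>n. 1 - z * q ^ n) has_prod qpoch q z"
  unfolding qpoch_def using convergent_prod_qpoch by blast

lemma tendsto_qpoch: "(\<lambda>N. \<Prod>n<N. 1 - z * q ^ n) \<longlonglongrightarrow> qpoch q z"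
  unfolding qpoch_def using convergent_prod_LIMSEQ[OF convergent_prod_qpoch] LIMSEQ_lessThan_iff_atMost
  by blast

end

context
  fixes q :: complex
  assumes q: "norm q < 1"
begin

lemma qpoch_eq_0_iff: "qpoch q z = 0 \<longleftrightarrow> (\<exists>n. z * q ^ n = 1)"
  using has_prod_eq_0_iff[OF has_prod_qpoch[OF q]] by auto

lemma qpoch_rec: "qpoch q z = (1 - z) * qpoch q (q * z)"
proof (rule LIMSEQ_unique)
  show "(\<lambda>N. \<Prod>n<Suc N. 1 - z * q ^ n) \<longlonglongrightarrow> qpoch q z"
    using tendsto_qpoch[OF q] LIMSEQ_Suc by blast
  have "(\<Prod>n<Suc N. 1 - z * q ^ n) = (1 - z) * (\<Prod>n<N. 1 - (q * z) * q ^ n)" for N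
    by (subst prod.lessThan_Suc_shift) (simp add: mult_ac)
  then show "(\<lambda>N. \<Prod>n<Suc N. 1 - z * q ^ n) \<longlonglongrightarrow> (1 - z) * qpoch q (q * z)"
    by (simp only:) (intro tendsto_intros tendsto_qpoch q)
qed

lemma qpoch_holomorphic [holomorphic_intros]:
  assumes "g holomorphic_on A"
  shows "(\<lambda>z. qpoch q (g z)) holomorphic_on A"
proof -
  have "qpoch q holomorphic_on UNIV"
    unfolding qpoch_def
  proof (rule holomorphic_prodinf)
    fix z :: complex
    have "summable (\<lambda>n. (norm z + 1) * norm q ^ n)"
      by (intro summable_mult summable_geometric) (use q in auto)
    moreover have "norm (1 - x * q ^ n - 1) \<le> (norm z + 1) * norm q ^ n" if "x \<in> cball z 1" for x n
    proof -
      have "norm x \<le> norm z + 1"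
        using that norm_triangle_ineq2[of x z] by (auto simp: dist_norm norm_minus_commute)
      then show ?thesis by (simp add: norm_mult norm_power mult_right_mono)
    qed
    ultimately show "\<exists>d M. 0 < d \<and> cball z d \<subseteq> UNIV \<and> summable M \<and>
        (\<forall>n. \<forall>x\<in>cball z d. norm (1 - x * q ^ n - 1) \<le> M n)"
      by (intro exI[of _ 1] exI[of _ "\<lambda>n. (norm z + 1) * norm q ^ n"]) auto
  qed (auto intro!: holomorphic_intros)
  from holomorphic_on_compose_gen[OF assms this] show ?thesis
    by (simp add: o_def)
qed

lemma norm_square_less_1: "norm (q\<^sup>2) < 1"
  using q by (simp add: norm_power power_less_one_iff)

lemma qpoch_split: "qpoch q z = qpoch (q\<^sup>2) z * qpoch (q\<^sup>2) (q * z)"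
proof (rule LIMSEQ_unique)
  show "(\<lambda>N. \<Prod>n<2*N. 1 - z * q ^ n) \<longlonglongrightarrow> qpoch q z"
    using LIMSEQ_subseq_LIMSEQ[OF tendsto_qpoch[OF q], of "\<lambda>N. 2 * N"] by (simp add: o_def strict_mono_def)
  have "(\<Prod>n<2*N. 1 - z * q ^ n) = (\<Prod>n<N. 1 - z * (q\<^sup>2) ^ n) * (\<Prod>n<N. 1 - (q * z) * (q\<^sup>2) ^ n)" for N
    by (induction N) (auto simp: power_mult[symmetric] mult_ac)
  then show "(\<lambda>N. \<Prod>n<2*N. 1 - z * q ^ n) \<longlonglongrightarrow> qpoch (q\<^sup>2) z * qpoch (q\<^sup>2) (q * z)"
    by (simp only:) (intro tendsto_intros tendsto_qpoch norm_square_less_1)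
qed

lemma qpoch_mult_minus: "qpoch q z * qpoch q (- z) = qpoch (q\<^sup>2) (z\<^sup>2)"
proof (rule LIMSEQ_unique)
  show "(\<lambda>N. (\<Prod>n<N. 1 - z * q ^ n) * (\<Prod>n<N. 1 - (- z) * q ^ n)) \<longlonglongrightarrow> qpoch q z * qpoch q (- z)"
    by (intro tendsto_intros tendsto_qpoch q)
  have "(\<Prod>n<N. 1 - z * q ^ n) * (\<Prod>n<N. 1 - (- z) * q ^ n) = (\<Prod>n<N. 1 - z\<^sup>2 * (q\<^sup>2) ^ n)" for N
    unfolding prod.distrib[symmetric]
    by (intro prod.cong refl) (simp add: power2_eq_square algebra_simps power_mult_distrib)
  then show "(\<lambda>N. (\<Prod>n<N. 1 - z * q ^ n) * (\<Prod>n<N. 1 - (- z) * q ^ n)) \<longlonglongrightarrow> qpoch (q\<^sup>2) (z\<^sup>2)"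
    by (simp only:) (intro tendsto_qpoch norm_square_less_1)
qed

lemma qpoch_nz: "norm z < 1 \<Longrightarrow> qpoch q z \<noteq> 0"
proof
  assume "norm z < 1" "qpoch q z = 0"
  then obtain n where n: "z * q ^ n = 1" using qpoch_eq_0_iff by blast
  have "norm (z * q ^ n) \<le> norm z * 1"
    unfolding norm_mult norm_power using q by (intro mult_left_mono power_le_one) auto
  with n \<open>norm z < 1\<close> show False by simp
qed

lemma qpoch_minus_nz: "qpoch q (- q) \<noteq> 0" "qpoch q q \<noteq> 0"
  using qpoch_nz[of "-q"] qpoch_nz[of q] q by auto

lemma qpoch_q_euler: "qpoch (q\<^sup>2) (q\<^sup>2) = qpoch q q * qpoch q (- q)"
  using qpoch_mult_minus by simp

end

text \<open>Euler's identity between odd parts and distinct parts, with q = p^2. The first two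
  factors give the even-indexed factors of (q; q); the odd-indexed ones are (q^2; q^2) = (q; q) (-q;
  q), so (q; q) cancels. It later removes the theta values at the half periods that involve
  w2.\<close>

lemma qpoch_square_root:
  assumes p: "norm p < 1"
  shows "qpoch (p\<^sup>2) p * qpoch (p\<^sup>2) (- p) * qpoch (p\<^sup>2) (- (p\<^sup>2)) = 1"
proof -
  have q: "norm (p\<^sup>2) < 1" by (rule norm_square_less_1[OF p])
  have "qpoch (p\<^sup>2) p * qpoch (p\<^sup>2) (- p) = qpoch ((p\<^sup>2)\<^sup>2) (p\<^sup>2)"
    by (rule qpoch_mult_minus[OF q])
  moreover have "qpoch (p\<^sup>2) (p\<^sup>2) = qpoch ((p\<^sup>2)\<^sup>2) (p\<^sup>2) * qpoch ((p\<^sup>2)\<^sup>2) (p\<^sup>2 * p\<^sup>2)"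
    by (rule qpoch_split[OF q])
  moreover have "qpoch ((p\<^sup>2)\<^sup>2) (p\<^sup>2 * p\<^sup>2) = qpoch (p\<^sup>2) (p\<^sup>2) * qpoch (p\<^sup>2) (- (p\<^sup>2))"
    using qpoch_q_euler[OF q] by (simp add: power2_eq_square)
  ultimately have "qpoch (p\<^sup>2) (p\<^sup>2) * (qpoch (p\<^sup>2) p * qpoch (p\<^sup>2) (- p) * qpoch (p\<^sup>2) (- (p\<^sup>2))) = qpoch (p\<^sup>2) (p\<^sup>2) * 1"
    by simp
  then show ?thesis
    using qpoch_minus_nz(2)[OF q] mult_left_cancel by blast
qed

lemma qpoch_diagonal_holomorphic: "(\<lambda>q. qpoch q q) holomorphic_on ball 0 1"
  unfolding qpoch_def
proof (rule holomorphic_prodinf)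
  fix z :: complex assume z: "z \<in> ball 0 1"
  \<comment> \<open>The disc reaches only half of the way to the unit circle, so its points are
    bounded by some r < 1 and a geometric series majorizes.\<close>
  define d where "d = (1 - norm z) / 2"
  define r where "r = norm z + d"
  have d: "d > 0" and r: "0 \<le> r" "r < 1"
    using z by (auto simp: d_def r_def field_simps)
  have le: "norm x \<le> r" if "x \<in> cball z d" for x
    using that norm_triangle_ineq2[of x z] by (auto simp: dist_norm norm_minus_commute r_def)
  have "cball z d \<subseteq> ball 0 1"
    using le r by fastforce
  moreover have "summable (\<lambda>n. r ^ Suc n)"
    using r by (subst summable_Suc_iff) (intro summable_geometric, auto)
  moreover have "norm (1 - x * x ^ n - 1) \<le> r ^ Suc n" if "x \<in> cball z d" for x n
  proof -
    have "norm (x ^ Suc n) \<le> r ^ Suc n"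
      unfolding norm_power using le[OF that] by (intro power_mono) auto
    then show ?thesis by simp
  qed
  ultimately show "\<exists>d M. 0 < d \<and> cball z d \<subseteq> ball 0 1 \<and> summable M \<and>
      (\<forall>n. \<forall>x\<in>cball z d. norm (1 - x * x ^ n - 1) \<le> M n)"
    using d by blast
qed (auto intro!: holomorphic_intros)

section \<open>A theta function\<close>

text \<open>Jacobi's theta function in the multiplicative variable, without the factor
  \<open>qpoch q q\<close> and the exponential prefactor.\<close>

definition thetaS :: "complex \<Rightarrow> complex \<Rightarrow> complex" where
  "thetaS q z = qpoch q z * qpoch q (q / z)"

context
  fixes q :: complex
  assumes q: "norm q < 1" and q0: "q \<noteq> 0"
begin

text \<open>Passing from z to q z drops the factor 1 - z from one product and adds 1 - 1/z to the
  other; the ratio of the two is -1/z.\<close>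

lemma thetaS_mult_q:
  assumes "z \<noteq> 0"
  shows "thetaS q (q * z) = - thetaS q z / z"
proof -
  have 1: "qpoch q z = (1 - z) * qpoch q (q * z)" by (rule qpoch_rec[OF q])
  have 2: "qpoch q (1 / z) = (1 - 1 / z) * qpoch q (q / z)" using qpoch_rec[OF q, of "1/z"] by simp
  have 3: "thetaS q (q * z) = qpoch q (q * z) * qpoch q (1 / z)"
    using assms q0 by (simp add: thetaS_def)
  show ?thesis unfolding 3 2 unfolding thetaS_def 1 using assms by (simp add: field_simps)
qed

lemma thetaS_inverse:
  assumes "z \<noteq> 0"
  shows "thetaS q (1 / z) = - thetaS q z / z"
proof -
  have "thetaS q (1 / z) = thetaS q (q * z)" using assms q0 by (simp add: thetaS_def mult_ac)
  then show ?thesis using thetaS_mult_q[OF assms] by simp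
qed

lemma thetaS_alt:
  assumes "z \<noteq> 0"
  shows "thetaS q z = (1 - z) * (qpoch q (q * z) * qpoch q (q / z))"
  using qpoch_rec[OF q, of z] by (simp add: thetaS_def)

text \<open>The first product vanishes at q^(-n) and the second at q^(n+1), for n >= 0; together
  these are all integer powers.\<close>

lemma thetaS_eq_0_iff:
  assumes "z \<noteq> 0"
  shows "thetaS q z = 0 \<longleftrightarrow> (\<exists>n::int. z = q powi n)"
proof
  assume "thetaS q z = 0"
  then consider n where "z * q ^ n = 1" | n where "q / z * q ^ n = 1"
    unfolding thetaS_def using qpoch_eq_0_iff[OF q] by auto
  then show "\<exists>n::int. z = q powi n"
  proof cases
    case (1 n)
    then have "z = q powi (- int n)"
      using q0 by (simp add: power_int_minus eq_divide_imp inverse_eq_divide)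
    then show ?thesis by blast
  next
    case (2 n)
    then have "z = q powi (int (Suc n))"
      using assms by (simp only: power_int_of_nat) (simp add: divide_eq_eq)
    then show ?thesis by blast
  qed
next
  assume "\<exists>n::int. z = q powi n"
  then obtain n :: int where n: "z = q powi n" by blast
  show "thetaS q z = 0"
  proof (cases "n \<le> 0")
    case True
    then have "z * q ^ nat (- n) = 1"
      using q0 n by (auto simp add: power_int_def simp flip: power_mult_distrib)
    then show ?thesis unfolding thetaS_def using qpoch_eq_0_iff[OF q] by auto
  next
    case False
    then have "z = q ^ Suc (nat (n - 1))"
      using n by (simp add: power_int_def Suc_nat_eq_nat_zadd1 del: power_Suc)
    then have "q / z * q ^ nat (n - 1) = 1"
      using assms by simp
    then show ?thesis unfolding thetaS_def using qpoch_eq_0_iff[OF q] by auto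
  qed
qed

lemma thetaS_holomorphic [holomorphic_intros]:
  assumes "g holomorphic_on A" "\<And>z. z \<in> A \<Longrightarrow> g z \<noteq> 0"
  shows "(\<lambda>z. thetaS q (g z)) holomorphic_on A"
  unfolding thetaS_def by (intro holomorphic_intros q assms)

lemma thetaS_minus_1: "thetaS q (-1) = 2 * (qpoch q (- q))\<^sup>2"
  using qpoch_rec[OF q, of "-1"] by (simp add: thetaS_def power2_eq_square)

end

section \<open>Lattices and elliptic functions\<close>

definition lattice :: "complex \<Rightarrow> complex \<Rightarrow> complex set" where
  "lattice w1 w2 = {of_int m * w1 + of_int n * w2 | m n. True}"

text \<open>Lattice points are left open: values there are arbitrary, and the singularity is
  prescribed separately, by the limit of w^2 f(w) at 0.\<close>

definition elliptic :: "complex set \<Rightarrow> (complex \<Rightarrow> complex) \<Rightarrow> bool" where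
  "elliptic L f \<longleftrightarrow> f holomorphic_on - L \<and> (\<forall>w l. w \<notin> L \<longrightarrow> l \<in> L \<longrightarrow> f (w + l) = f w)"

text \<open>Write f = (w - h) g with g holomorphic and g(h) = 0. Then f' = g + (w - h) g', whose
  derivative at h is 2 g'(h), while f/(w - h)^2 is the difference quotient of g.\<close>

lemma second_order_zero_tendsto:
  assumes hol: "f holomorphic_on S" and S: "open S" "h \<in> S" and zero: "f h = 0" "deriv f h = 0"
  shows "(\<lambda>w. f w / (w - h)\<^sup>2) \<midarrow>h\<rightarrow> deriv (deriv f) h / 2"
proof -
  define g where "g z = (if z = h then deriv f h else (f z - f h) / (z - h))" for z
  have g: "g holomorphic_on S"
    unfolding g_def by (rule pole_lemma_open[OF hol S(1)])
  have gh: "g h = 0" by (simp add: g_def zero)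
  have fg: "f z = (z - h) * g z" for z by (simp add: g_def zero)
  have gd: "(g has_field_derivative deriv g w) (at w)" if "w \<in> S" for w
    using g S(1) that holomorphic_derivI by blast
  have dg: "deriv g holomorphic_on S" using g S(1) by (rule holomorphic_deriv)
  have df: "deriv f w = g w + (w - h) * deriv g w" if "w \<in> S" for w
  proof (rule DERIV_imp_deriv)
    have "((\<lambda>z. (z - h) * g z) has_field_derivative g w + (w - h) * deriv g w) (at w)"
      using gd[OF that] by (auto intro!: derivative_eq_intros)
    then show "(f has_field_derivative g w + (w - h) * deriv g w) (at w)"
      unfolding fg[abs_def] .
  qed
  have "((\<lambda>w. g w + (w - h) * deriv g w) has_field_derivative 2 * deriv g h) (at h)"
    using gd[OF S(2)] holomorphic_derivI[OF dg S] by (auto intro!: derivative_eq_intros)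
  moreover have "eventually (\<lambda>w. deriv f w = g w + (w - h) * deriv g w) (nhds h)"
    using eventually_nhds_in_open[OF S] df by (auto elim: eventually_mono)
  ultimately have "(deriv f has_field_derivative 2 * deriv g h) (at h)"
    by (subst DERIV_cong_ev[OF refl _ refl])
  then have "deriv (deriv f) h = 2 * deriv g h"
    by (rule DERIV_imp_deriv)
  moreover have "(\<lambda>w. (g w - g h) / (w - h)) \<midarrow>h\<rightarrow> deriv g h"
    using gd[OF S(2)] by (simp add: has_field_derivative_iff)
  moreover have "(g w - g h) / (w - h) = f w / (w - h)\<^sup>2" for w
    using fg[of w] by (simp add: power2_eq_square gh)
  ultimately show ?thesis by simp
qed

lemma moebius_denominator_nz:
  fixes p q r s :: real
  assumes "Im \<tau> > 0" "p * s - q * r = 1"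
  shows "of_real r * \<tau> + of_real s \<noteq> 0"
proof
  assume z: "of_real r * \<tau> + of_real s = 0"
  have "Im (of_real r * \<tau> + of_real s) = r * Im \<tau>" by simp
  then have "r = 0" using assms(1) z by simp
  then have "s = 0" using z by simp
  with \<open>r = 0\<close> assms(2) show False by simp
qed

text \<open>For numerator n and denominator d, Im (n/d) has the sign of Im n Re d - Re n Im d, which
  is the determinant times Im \<tau>.\<close>

lemma Im_moebius_pos:
  fixes p q r s :: real
  assumes "Im \<tau> > 0" "p * s - q * r = 1"
  shows "Im ((of_real p * \<tau> + of_real q) / (of_real r * \<tau> + of_real s)) > 0"
proof -
  define n d where "n = of_real p * \<tau> + of_real q" and "d = of_real r * \<tau> + of_real s"
  have "d \<noteq> 0" unfolding d_def by (rule moebius_denominator_nz[OF assms])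
  then have "(Re d)\<^sup>2 + (Im d)\<^sup>2 > 0" by (metis complex_neq_0)
  moreover have "Im n * Re d - Re n * Im d = Im \<tau> * (p * s - q * r)"
    by (simp add: n_def d_def algebra_simps)
  ultimately show ?thesis
    using assms unfolding n_def[symmetric] d_def[symmetric] Im_divide by simp
qed

section \<open>Lattice coordinates, discreteness and the period cell\<close>

locale period_basis =
  fixes w1 w2 :: complex
  assumes Im_pos: "Im (w2 / w1) > 0"
begin

abbreviation L where "L \<equiv> lattice w1 w2"

lemma w1_nz: "w1 \<noteq> 0" using Im_pos by auto

text \<open>\<open>cs\<close> and \<open>ct\<close> are the real coordinates of w in the basis (w1,
  w2), found after division by w1.\<close>

definition cs :: "complex \<Rightarrow> real" where
  "cs w = Re (w / w1) - Im (w / w1) / Im (w2 / w1) * Re (w2 / w1)"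
definition ct :: "complex \<Rightarrow> real" where
  "ct w = Im (w / w1) / Im (w2 / w1)"

lemma coords: "w = of_real (cs w) * w1 + of_real (ct w) * w2"
proof -
  have "w / w1 = of_real (cs w) + of_real (ct w) * (w2 / w1)"
    using Im_pos by (simp add: complex_eq_iff cs_def ct_def del: times_divide_eq_right)
  then show ?thesis using w1_nz by (simp add: field_simps)
qed

lemma ct_comb: "ct (of_real s * w1 + of_real t * w2) = t"
proof -
  have "(of_real s * w1 + of_real t * w2) / w1 = of_real s + of_real t * (w2 / w1)"
    using w1_nz by (simp add: field_simps)
  then show ?thesis using Im_pos by (simp add: ct_def del: times_divide_eq_right)
qed

lemma cs_comb: "cs (of_real s * w1 + of_real t * w2) = s"
proof -
  have "(of_real s * w1 + of_real t * w2) / w1 = of_real s + of_real t * (w2 / w1)"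
    using w1_nz by (simp add: field_simps)
  then show ?thesis using Im_pos by (simp add: cs_def del: times_divide_eq_right)
qed

lemma lattice_iff: "w \<in> L \<longleftrightarrow> cs w \<in> \<int> \<and> ct w \<in> \<int>"
proof
  assume "w \<in> L"
  then obtain m n where "w = of_real (of_int m) * w1 + of_real (of_int n) * w2"
    by (auto simp: lattice_def)
  then show "cs w \<in> \<int> \<and> ct w \<in> \<int>" by (simp only: cs_comb ct_comb Ints_of_int)
next
  assume "cs w \<in> \<int> \<and> ct w \<in> \<int>"
  then obtain m n where "cs w = of_int m" "ct w = of_int n" by (auto elim!: Ints_cases)
  then have "w = of_int m * w1 + of_int n * w2" using coords[of w] by simp
  then show "w \<in> L" by (auto simp: lattice_def)
qed

lemma comb_in_lattice_iff: "of_real s * w1 + of_real t * w2 \<in> L \<longleftrightarrow> s \<in> \<int> \<and> t \<in> \<int>"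
  by (simp add: lattice_iff cs_comb ct_comb)

lemma cs_diff: "cs (v - w) = cs v - cs w" and ct_diff: "ct (v - w) = ct v - ct w"
  by (simp_all add: cs_def ct_def diff_divide_distrib algebra_simps)

lemma lattice_diff: "v \<in> L \<Longrightarrow> w \<in> L \<Longrightarrow> v - w \<in> L"
  by (simp add: lattice_iff cs_diff ct_diff)

lemma lattice_0: "0 \<in> L"
  by (simp add: lattice_iff cs_def ct_def)

lemma lattice_minus: "v \<in> L \<Longrightarrow> - v \<in> L"
  using lattice_diff[OF lattice_0] by simp

lemma lattice_add: "v \<in> L \<Longrightarrow> w \<in> L \<Longrightarrow> v + w \<in> L"
  using lattice_diff[OF _ lattice_minus, of v w] by simp

lemma lattice_minus_iff: "- v \<in> L \<longleftrightarrow> v \<in> L"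
  using lattice_minus[of v] lattice_minus[of "-v"] by auto

lemma lattice_add_iff: "l \<in> L \<Longrightarrow> v + l \<in> L \<longleftrightarrow> v \<in> L"
  using lattice_diff[of "v + l" l] lattice_add by auto

lemma isCont_coords: "isCont cs w" "isCont ct w"
  unfolding cs_def ct_def using w1_nz Im_pos by (auto intro!: continuous_intros)

lemma closed_lattice: "closed L"
proof -
  have "L = (cs -` \<int>) \<inter> (ct -` \<int>)" by (auto simp: lattice_iff)
  moreover have "closed (cs -` \<int>)" "closed (ct -` \<int>)"
    by (intro continuous_closed_vimage closed_Ints isCont_coords)+
  ultimately show ?thesis by (simp add: closed_Int)
qed

text \<open>Lattice points have integral coordinates, so two of them whose coordinates differ by
  less than 1 coincide.\<close>

lemma eventually_not_lattice: "eventually (\<lambda>w. w \<notin> L) (at z)"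
proof (cases "z \<in> L")
  case True
  have "(cs \<longlongrightarrow> cs z) (at z)" "(ct \<longlongrightarrow> ct z) (at z)"
    using isCont_coords by (auto simp: isCont_def)
  then have "eventually (\<lambda>w. dist (cs w) (cs z) < 1) (at z)" "eventually (\<lambda>w. dist (ct w) (ct z) < 1) (at z)"
    by (auto simp: tendsto_iff)
  moreover have "eventually (\<lambda>w. w \<noteq> z) (at z)" by (simp add: eventually_at_filter)
  ultimately show ?thesis
  proof eventually_elim
    case (elim w)
    show ?case
    proof
      assume "w \<in> L"
      then have "cs w - cs z \<in> \<int>" "ct w - ct z \<in> \<int>"
        using True by (auto simp: lattice_iff)
      then have "cs w - cs z = 0" "ct w - ct z = 0"
        using elim(1,2) by (metis Ints_nonzero_abs_less1 dist_real_def)+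
      then have "cs w = cs z" "ct w = ct z" by auto
      then have "w = z" using coords[of w] coords[of z] by metis
      with elim show False by simp
    qed
  qed
next
  case False
  then have "eventually (\<lambda>w. w \<in> - L) (at z)"
    using closed_lattice by (intro eventually_at_in_open') auto
  then show ?thesis by simp
qed

lemma eventually_not_lattice_shift: "eventually (\<lambda>w. w - h \<notin> L) (at z)"
proof -
  obtain d where d: "d > 0" "\<And>w. w \<noteq> z - h \<Longrightarrow> dist w (z - h) < d \<Longrightarrow> w \<notin> L"
    using eventually_not_lattice[of "z - h"] unfolding eventually_at by blast
  then show ?thesis
    unfolding eventually_at by (intro exI[of _ d]) (auto simp: dist_norm)
qed

definition cell :: "complex set" where
  "cell = (\<lambda>(s, t). of_real s * w1 + of_real t * w2) ` ({0..1} \<times> {0..1})"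

lemma compact_cell: "compact cell"
  unfolding cell_def split_def
  by (intro compact_continuous_image compact_Times continuous_intros) auto

lemma translate_to_cell: obtains l where "l \<in> L" "w + l \<in> cell"
proof
  define l where "l = of_int (- \<lfloor>cs w\<rfloor>) * w1 + of_int (- \<lfloor>ct w\<rfloor>) * w2"
  show "l \<in> L" unfolding l_def lattice_def by blast
  have "w + l = of_real (frac (cs w)) * w1 + of_real (frac (ct w)) * w2"
    using coords[of w] by (simp add: l_def frac_def algebra_simps)
  moreover have "frac (cs w) \<in> {0..1}" "frac (ct w) \<in> {0..1}"
    using frac_lt_1 less_imp_le by auto
  ultimately show "w + l \<in> cell" unfolding cell_def by (auto intro!: image_eqI[of _ _ "(frac (cs w), frac (ct w))"])
qed

text \<open>Periodicity is assumed only off L and h + L, where F may be a quotient by 0; a limit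
  ignores these exceptional points because they are isolated.\<close>

lemma elliptic_shift_tendsto:
  assumes F: "\<And>w l. w \<notin> L \<Longrightarrow> w - h \<notin> L \<Longrightarrow> l \<in> L \<Longrightarrow> F (w + l) = F w"
    and lim: "F \<midarrow>z\<rightarrow> c" and l: "l \<in> L"
  shows "F \<midarrow>z + l\<rightarrow> c"
proof -
  have "(\<lambda>w. F (w - l)) \<midarrow>z + l\<rightarrow> c"
    using LIM_offset[OF lim, of "- l"] by simp
  moreover have "eventually (\<lambda>w. F (w - l) = F w) (at (z + l))"
    using eventually_not_lattice eventually_not_lattice_shift[of h]
  proof eventually_elim
    case (elim w)
    have "F (w + - l) = F w"
      using elim l by (intro F lattice_minus)
    then show ?case by simp
  qed
  ultimately show ?thesis
    using filterlim_cong by force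
qed

text \<open>
  The quotient of the two functions extends to an entire, doubly periodic function.
\<close>

lemma elliptic_ratio:
  assumes f: "elliptic L f" and g: "elliptic L g"
    and f0: "(\<lambda>w. w\<^sup>2 * f w) \<midarrow>0\<rightarrow> \<alpha>" and g0: "(\<lambda>w. w\<^sup>2 * g w) \<midarrow>0\<rightarrow> \<beta>" and \<beta>: "\<beta> \<noteq> 0"
    and h: "h \<notin> L"
    and gz: "\<And>w. w \<notin> L \<Longrightarrow> g w = 0 \<Longrightarrow> w - h \<in> L" and gh: "g h = 0"
    and gh2: "(\<lambda>w. g w / (w - h)\<^sup>2) \<midarrow>h\<rightarrow> \<gamma>" and \<gamma>: "\<gamma> \<noteq> 0"
    and fh: "f h = 0" and fh': "deriv f h = 0"
    and w: "w \<notin> L"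
  shows "f w = \<alpha> / \<beta> * g w"
proof -
  define F where "F w = f w / g w" for w
  \<comment> \<open>The poles and the zeros of g: only there can the quotient F fail to be the
    intended one.\<close>
  define A where "A = L \<union> {w. w - h \<in> L}"
  have fhol: "f holomorphic_on - L" and ghol: "g holomorphic_on - L"
    and fper: "\<And>w l. w \<notin> L \<Longrightarrow> l \<in> L \<Longrightarrow> f (w + l) = f w"
    and gper: "\<And>w l. w \<notin> L \<Longrightarrow> l \<in> L \<Longrightarrow> g (w + l) = g w"
    using f g by (auto simp: elliptic_def)
  have Fper: "F (w + l) = F w" if "w \<notin> L" "l \<in> L" for w l
    using that by (simp add: F_def fper gper)
  have Fhol: "F holomorphic_on - A"
    unfolding F_def using gz
    by (intro holomorphic_intros holomorphic_on_subset[OF fhol] holomorphic_on_subset[OF ghol])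
       (auto simp: A_def)
  have evA: "eventually (\<lambda>w. w \<notin> A) (at z)" for z
    using eventually_not_lattice[of z] eventually_not_lattice_shift[of h z]
    by eventually_elim (auto simp: A_def)
  have isolated: "isolated_singularity_at F z" for z
  proof -
    obtain d where d: "d > 0" "\<And>w. w \<noteq> z \<Longrightarrow> dist w z < d \<Longrightarrow> w \<notin> A"
      using evA[of z] unfolding eventually_at by blast
    have "F holomorphic_on ball z d - {z}"
      using d by (intro holomorphic_on_subset[OF Fhol]) (auto simp: dist_commute)
    then show ?thesis
      using d(1) by (intro isolated_singularity_at_holomorphic[of F "ball z d"]) auto
  qed
  have lim0: "F \<midarrow>0\<rightarrow> \<alpha> / \<beta>"
  proof -
    have "(\<lambda>w. (w\<^sup>2 * f w) / (w\<^sup>2 * g w)) \<midarrow>0\<rightarrow> \<alpha> / \<beta>"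
      by (intro tendsto_divide f0 g0 \<beta>)
    moreover have "eventually (\<lambda>w. (w\<^sup>2 * f w) / (w\<^sup>2 * g w) = F w) (at 0)"
      by (auto simp: F_def eventually_at_filter)
    ultimately show ?thesis using filterlim_cong by force
  qed
  \<comment> \<open>At h a zero of order at least two is divided by one of order exactly two. The
    limit may be 0; only \<gamma> must not vanish.\<close>
  have limh: "F \<midarrow>h\<rightarrow> (deriv (deriv f) h / 2) / \<gamma>"
  proof -
    have "(\<lambda>w. (f w / (w - h)\<^sup>2) / (g w / (w - h)\<^sup>2)) \<midarrow>h\<rightarrow> (deriv (deriv f) h / 2) / \<gamma>"
      using closed_lattice h fh fh'
      by (intro tendsto_divide second_order_zero_tendsto[OF fhol] gh2 \<gamma>) auto
    moreover have "eventually (\<lambda>w. (f w / (w - h)\<^sup>2) / (g w / (w - h)\<^sup>2) = F w) (at h)"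
      by (auto simp: F_def eventually_at_filter)
    ultimately show ?thesis using filterlim_cong by force
  qed
  have lim: "\<exists>c. F \<midarrow>z\<rightarrow> c" for z
  proof -
    consider "z \<in> L" | "z - h \<in> L" | "z \<notin> A" by (auto simp: A_def)
    then show ?thesis
    proof cases
      case 1
      have "F \<midarrow>0 + z\<rightarrow> \<alpha> / \<beta>"
        by (rule elliptic_shift_tendsto[where h = h]) (use Fper lim0 1 in auto)
      then show ?thesis by auto
    next
      case 2
      have "F \<midarrow>h + (z - h)\<rightarrow> (deriv (deriv f) h / 2) / \<gamma>"
        by (rule elliptic_shift_tendsto[where h = h]) (use Fper limh 2 in auto)
      then show ?thesis by auto
    next
      case 3
      have "A = L \<union> (\<lambda>w. w - h) -` L" by (auto simp: A_def)
      then have "open (- A)"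
        using closed_lattice
        by (auto intro!: closed_Un continuous_closed_vimage continuous_intros)
      then have "isCont F z"
        using 3 Fhol holomorphic_on_imp_continuous_on continuous_on_eq_continuous_at by blast
      then show ?thesis by (auto simp: isCont_def)
    qed
  qed
  \<comment> \<open>F has a finite limit at every point, so all its singularities are removable and
    H is entire.\<close>
  define H where "H = remove_sings F"
  have "H analytic_on {z}" for z
    unfolding H_def using lim[of z] isolated remove_sings_analytic_at by blast
  then have H: "H holomorphic_on UNIV"
    by (meson analytic_imp_holomorphic analytic_on_analytic_at)
  then have Hcont: "continuous_on UNIV H" by (rule holomorphic_on_imp_continuous_on)
  have HF: "H w = F w" if "w \<notin> A" for w
  proof -
    have "A = L \<union> (\<lambda>w. w - h) -` L" by (auto simp: A_def)
    then have "open (- A)"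
      using closed_lattice by (auto intro!: closed_Un continuous_closed_vimage continuous_intros)
    then show ?thesis
      unfolding H_def using that Fhol
      by (intro remove_sings_at_analytic) (auto intro: holomorphic_on_imp_analytic_at)
  qed
  have "compact (H ` cell)"
    using compact_cell Hcont by (intro compact_continuous_image continuous_on_subset[OF Hcont]) auto
  then obtain B where B: "\<And>w. w \<in> cell \<Longrightarrow> norm (H w) \<le> B"
    using compact_imp_bounded bounded_iff by (metis imageI)
  have bound: "norm (H w) \<le> B" if "w \<notin> A" for w
  proof -
    obtain l where l: "l \<in> L" "w + l \<in> cell" using translate_to_cell by blast
    have "w + l \<notin> A"
      using that l(1) lattice_add_iff[OF l(1), of w] lattice_add_iff[OF l(1), of "w - h"]
      by (auto simp: A_def algebra_simps)
    then have "H w = H (w + l)" using that l(1) by (auto simp: HF Fper A_def)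
    then show ?thesis using B[OF l(2)] by simp
  qed
  \<comment> \<open>Translation into the cell was justified off A only; the remaining points inherit
    the bound by continuity.\<close>
  have "norm (H z) \<le> B" for z
  proof (rule Lim_norm_ubound)
    show "H \<midarrow>z\<rightarrow> H z" using Hcont by (simp add: continuous_on_def)
    show "eventually (\<lambda>w. norm (H w) \<le> B) (at z)"
      using evA[of z] by eventually_elim (rule bound)
  qed auto
  then have "bounded (range H)" by (auto simp: bounded_iff)
  then obtain c where c: "\<And>z. H z = c"
    using Liouville_theorem[OF H] by (auto simp: constant_on_def)
  have "H 0 = \<alpha> / \<beta>" unfolding H_def using lim0 by (rule remove_sings_eqI)
  then have Hc: "H z = \<alpha> / \<beta>" for z using c by metis
  show ?thesis
  \<comment> \<open>On h + L the quotient is 0/0 and says nothing about f, but there both sides of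
    the claim vanish by periodicity.\<close>
  proof (cases "w - h \<in> L")
    case True
    have "f w = f h" "g w = g h"
      using fper[OF h True] gper[OF h True] by auto
    then show ?thesis by (simp add: fh gh)
  next
    case False
    then have "w \<notin> A" using w by (auto simp: A_def)
    then have "F w = \<alpha> / \<beta>" using HF Hc by metis
    moreover have "g w \<noteq> 0" using gz w False by blast
    ultimately show ?thesis by (simp add: F_def divide_eq_eq)
  qed
qed

end

lemma continuous_on_UNIV_tendsto: "continuous_on UNIV f \<Longrightarrow> f \<midarrow>a\<rightarrow> f a"
  by (simp add: continuous_on_def)

section \<open>The theta function of a period basis\<close>

context period_basis
begin

text \<open>\<open>zeta\<close> identifies the plane modulo multiples of w1 with the punctured plane
  and turns translation by w2 into multiplication by \<open>q\<close>.\<close>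

definition q where "q = exp (2 * of_real pi * \<i> * (w2 / w1))"
definition zeta where "zeta w = exp (2 * of_real pi * \<i> * (w / w1))"
definition Theta where "Theta w = thetaS q (zeta w)"

lemma norm_q: "norm q < 1"
  using Im_pos by (simp add: q_def mult.assoc del: times_divide_eq_right)

lemma q_nz: "q \<noteq> 0" by (simp add: q_def)

lemma zeta_nz: "zeta w \<noteq> 0" by (simp add: zeta_def)

lemma zeta_add: "zeta (v + w) = zeta v * zeta w"
  by (simp add: zeta_def add_divide_distrib ring_distribs exp_add)

lemma zeta_minus: "zeta (- w) = 1 / zeta w"
  by (simp add: zeta_def exp_minus inverse_eq_divide)

lemma zeta_diff: "zeta (v - w) = zeta v / zeta w"
  using zeta_add[of v "- w"] by (simp add: zeta_minus)

lemma zeta_w1: "zeta w1 = 1" and zeta_w2: "zeta w2 = q" and zeta_0: "zeta 0 = 1"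
  using w1_nz by (simp_all add: zeta_def q_def)

lemma zeta_half_w1: "zeta (w1 / 2) = -1"
  using w1_nz by (simp add: zeta_def)

lemma Theta_w1: "Theta (w + w1) = Theta w"
  by (simp add: Theta_def zeta_add zeta_w1)

lemma Theta_w2: "Theta (w + w2) = - Theta w / zeta w"
  using thetaS_mult_q[OF norm_q q_nz zeta_nz[of w]] by (simp add: Theta_def zeta_add zeta_w2 mult.commute)

lemma Theta_minus: "Theta (- w) = - Theta w / zeta w"
  using thetaS_inverse[OF norm_q q_nz zeta_nz[of w]] by (simp add: Theta_def zeta_minus)

lemma Theta_holomorphic [holomorphic_intros]:
  "f holomorphic_on A \<Longrightarrow> (\<lambda>w. Theta (f w)) holomorphic_on A"
  unfolding Theta_def zeta_def
  using w1_nz by (intro holomorphic_intros norm_q q_nz) auto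

lemma zeta_holomorphic [holomorphic_intros]:
  "f holomorphic_on A \<Longrightarrow> (\<lambda>w. zeta (f w)) holomorphic_on A"
  unfolding zeta_def using w1_nz by (intro holomorphic_intros) auto

text \<open>The zeros of \<open>thetaS\<close> are the powers of q, and \<open>zeta w\<close>
  determines w up to multiples of w1.\<close>

lemma Theta_eq_0_iff: "Theta w = 0 \<longleftrightarrow> w \<in> L"
proof -
  have "zeta w = q powi n \<longleftrightarrow> (\<exists>m::int. w = of_int m * w1 + of_int n * w2)" for n :: int
  proof -
    have "zeta w = q powi n \<longleftrightarrow>
        exp (2 * of_real pi * \<i> * (w / w1)) = exp (of_int n * (2 * of_real pi * \<i> * (w2 / w1)))"
      by (simp add: zeta_def q_def exp_power_int)
    also have "\<dots> \<longleftrightarrow> (\<exists>m::int. 2 * of_real pi * \<i> * (w / w1) =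
        of_int n * (2 * of_real pi * \<i> * (w2 / w1)) + (of_int (2 * m) * of_real pi) * \<i>)"
      unfolding exp_eq by simp
    also have "\<dots> \<longleftrightarrow> (\<exists>m::int. w = of_int m * w1 + of_int n * w2)"
    proof (rule ex_cong1)
      fix m :: int
      have "2 * of_real pi * \<i> * (w / w1) - (of_int n * (2 * of_real pi * \<i> * (w2 / w1)) + (of_int (2 * m) * of_real pi) * \<i>)
          = (2 * of_real pi * \<i> / w1) * (w - (of_int m * w1 + of_int n * w2))"
        using w1_nz by (simp add: field_simps)
      moreover have "2 * of_real pi * \<i> / w1 \<noteq> 0" using w1_nz by simp
      ultimately show "2 * of_real pi * \<i> * (w / w1) =
          of_int n * (2 * of_real pi * \<i> * (w2 / w1)) + (of_int (2 * m) * of_real pi) * \<i> \<longleftrightarrow>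
          w = of_int m * w1 + of_int n * w2"
        by (metis eq_iff_diff_eq_0 mult_eq_0_iff)
    qed
    finally show ?thesis .
  qed
  then show ?thesis
    unfolding Theta_def thetaS_eq_0_iff[OF norm_q q_nz zeta_nz] lattice_def by auto
qed

text \<open>The single factor 1 - \<open>zeta w\<close> carries the simple zero; each of the two
  remaining products tends to \<open>qpoch q q\<close>.\<close>

lemma Theta_derivative_0: "(\<lambda>w. Theta w / w) \<midarrow>0\<rightarrow> - (2 * of_real pi * \<i> / w1) * (qpoch q q)\<^sup>2"
proof -
  have "(zeta has_field_derivative (2 * of_real pi * \<i> / w1)) (at 0)"
    unfolding zeta_def using w1_nz by (auto intro!: derivative_eq_intros)
  then have "(\<lambda>w. (zeta w - 1) / w) \<midarrow>0\<rightarrow> 2 * of_real pi * \<i> / w1"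
    by (simp add: has_field_derivative_iff zeta_0)
  moreover have "(\<lambda>w. qpoch q (q * zeta w) * qpoch q (q / zeta w)) \<midarrow>0\<rightarrow> qpoch q (q * zeta 0) * qpoch q (q / zeta 0)"
  proof -
    have "(\<lambda>w. qpoch q (q * zeta w) * qpoch q (q / zeta w)) holomorphic_on UNIV"
      using norm_q zeta_nz by (intro holomorphic_intros) auto
    then show ?thesis
      by (intro continuous_on_UNIV_tendsto holomorphic_on_imp_continuous_on)
  qed
  ultimately have "(\<lambda>w. - ((zeta w - 1) / w) * (qpoch q (q * zeta w) * qpoch q (q / zeta w))) \<midarrow>0\<rightarrow>
      - (2 * of_real pi * \<i> / w1) * (qpoch q (q * zeta 0) * qpoch q (q / zeta 0))"
    using tendsto_mult[OF tendsto_minus] by fastforce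
  moreover have "- ((zeta w - 1) / w) * (qpoch q (q * zeta w) * qpoch q (q / zeta w)) = Theta w / w" for w
    unfolding Theta_def thetaS_alt[OF norm_q q_nz zeta_nz]
    by (simp add: minus_divide_left)
  ultimately show ?thesis by (simp add: zeta_0 power2_eq_square)
qed

section \<open>Elliptic functions of order two\<close>

text \<open>
  For $(h, k) = (w_1/2, 0)$ and $(w_2/2, 1)$ these are the squares of the theta quotients
  $\theta_2/\theta_1$ and $\theta_4/\theta_1$ up to a constant factor; the power of \<^term>\<open>zeta\<close>
  cancels the factor picked up under translation by $w_2$, and the constant makes the principal
  part at the origin $4/w^2$, as for the coordinate $x$ of the curve.
\<close>

definition Yconst where
  "Yconst h = 4 * (2 * of_real pi * \<i> / w1)\<^sup>2 * qpoch q q ^ 4 / (Theta h)\<^sup>2"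

definition Y where
  "Y h k w = Yconst h * zeta w ^ k * (Theta (w + h) / Theta w)\<^sup>2"

lemma periodic_lattice:
  assumes "\<And>w. f (w + w1) = f w" "\<And>w. f (w + w2) = f w" "l \<in> L"
  shows "f (w + l) = f w"
proof -
  have *: "f (w + of_int m * p) = f w" if p: "\<And>w. f (w + p) = f w" for p m w
  proof (induction m rule: int_induct[where k = 0])
    case (step1 i)
    then show ?case using p[of "w + of_int i * p"] by (simp add: algebra_simps)
  next
    case (step2 i)
    then show ?case using p[of "w + of_int (i - 1) * p"] by (simp add: algebra_simps)
  qed simp
  obtain m n where l: "l = of_int m * w1 + of_int n * w2"
    using assms(3) by (auto simp: lattice_def)
  show ?thesis
    using *[of w1 "w + of_int n * w2" m] *[of w2 w n] assms(1,2) by (simp add: l algebra_simps)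
qed

context
  fixes h :: complex and k :: nat
  assumes h: "h \<notin> L" and zeta_h: "(zeta h)\<^sup>2 = q ^ k" and k: "k = 0 \<or> k = 1"
begin

lemma Yconst_nz: "Yconst h \<noteq> 0"
  using h w1_nz qpoch_minus_nz[OF norm_q] by (simp add: Yconst_def Theta_eq_0_iff)

text \<open>The assumption on \<open>zeta h\<close> says that 2 h equals k w2 up to multiples of w1,
  so \<open>Theta\<close> sees the shift by 2 h as a shift by k w2. In particular h is a half
  period.\<close>

lemma Theta_2h: "(Theta (w + 2 * h))\<^sup>2 = (Theta w)\<^sup>2 / zeta w ^ (2 * k)"
proof -
  have z: "zeta (w + 2 * h) = zeta w * q ^ k"
    unfolding zeta_h[symmetric] mult_2 zeta_add power2_eq_square by (rule refl)
  from k show ?thesis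
  proof
    assume "k = 0"
    then show ?thesis by (simp add: Theta_def z)
  next
    assume k1: "k = 1"
    then have "zeta (w + 2 * h) = zeta (w + w2)" by (simp only: z zeta_add[of w w2] zeta_w2 power_one_right)
    then have "Theta (w + 2 * h) = Theta (w + w2)" by (simp only: Theta_def)
    then show ?thesis by (simp add: Theta_w2 power_divide k1)
  qed
qed

lemma twice_in_lattice: "2 * h \<in> L"
  using Theta_2h[of 0] lattice_0 by (simp add: Theta_eq_0_iff[symmetric])

lemma Y_holomorphic: "Y h k holomorphic_on - L"
  unfolding Y_def[abs_def] by (intro holomorphic_intros) (auto simp: Theta_eq_0_iff)

lemma Y_elliptic: "elliptic L (Y h k)"
proof -
  have 1: "Y h k (w + w1) = Y h k w" for w
    using Theta_w1[of w] Theta_w1[of "w + h"] by (simp add: Y_def zeta_add zeta_w1 add_ac)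
  have 2: "Y h k (w + w2) = Y h k w" for w
  proof -
    have "Theta (w + w2 + h) = - Theta (w + h) / (zeta w * zeta h)"
      using Theta_w2[of "w + h"] by (simp add: zeta_add add_ac)
    then have "Y h k (w + w2) = Yconst h * (zeta w * q) ^ k * (Theta (w + h) / Theta w)\<^sup>2 / (zeta h)\<^sup>2"
      unfolding Y_def using zeta_nz by (simp add: zeta_add zeta_w2 Theta_w2 power_divide power_mult_distrib)
    also have "\<dots> = Y h k w"
      using q_nz by (simp add: zeta_h Y_def power_mult_distrib)
    finally show ?thesis .
  qed
  show ?thesis
    unfolding elliptic_def using Y_holomorphic periodic_lattice[OF 1 2] by blast
qed

lemma Y_pole: "(\<lambda>w. w\<^sup>2 * Y h k w) \<midarrow>0\<rightarrow> 4"
proof -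
  have cont: "continuous_on UNIV (\<lambda>w. Yconst h * zeta w ^ k * (Theta (w + h))\<^sup>2)"
    by (intro holomorphic_on_imp_continuous_on holomorphic_intros)
  then have "(\<lambda>w. Yconst h * zeta w ^ k * (Theta (w + h))\<^sup>2) \<midarrow>0\<rightarrow> Yconst h * zeta 0 ^ k * (Theta (0 + h))\<^sup>2"
    by (rule continuous_on_UNIV_tendsto)
  then have "(\<lambda>w. Yconst h * zeta w ^ k * (Theta (w + h))\<^sup>2 / (Theta w / w)\<^sup>2) \<midarrow>0\<rightarrow>
      Yconst h * zeta 0 ^ k * (Theta (0 + h))\<^sup>2 / (- (2 * of_real pi * \<i> / w1) * (qpoch q q)\<^sup>2)\<^sup>2"
    using w1_nz qpoch_minus_nz[OF norm_q] by (intro tendsto_divide tendsto_power Theta_derivative_0) auto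
  moreover have "Yconst h * zeta 0 ^ k * (Theta (0 + h))\<^sup>2 / (- (2 * of_real pi * \<i> / w1) * (qpoch q q)\<^sup>2)\<^sup>2 = 4"
    using h w1_nz qpoch_minus_nz[OF norm_q]
    by (simp add: Yconst_def zeta_0 Theta_eq_0_iff power_mult_distrib field_simps)
  moreover have "Yconst h * zeta w ^ k * (Theta (w + h))\<^sup>2 / (Theta w / w)\<^sup>2 = w\<^sup>2 * Y h k w" for w
    by (simp add: Y_def power_divide)
  ultimately show ?thesis by simp
qed

text \<open>The numerator at w cancels the denominator at w + h, and Theta (w + 2 h) returns to
  Theta w up to a power of \<open>zeta\<close> that cancels. For the curve this is translation by
  (0,0), which sends x to b/x.\<close>

lemma Y_mult_shift:
  assumes "w \<notin> L" "w + h \<notin> L"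
  shows "Y h k w * Y h k (w + h) = (Yconst h)\<^sup>2 * zeta h ^ k"
proof -
  have nz: "Theta w \<noteq> 0" "Theta (w + h) \<noteq> 0" using assms by (auto simp: Theta_eq_0_iff)
  have w2h: "w + h + h = w + 2 * h" by simp
  have alg: "c * z ^ k * (t2 / t1)\<^sup>2 * (c * (z * y) ^ k * (t3 / t2)\<^sup>2) = c\<^sup>2 * y ^ k * (z ^ (2 * k) * t3\<^sup>2 / t1\<^sup>2)"
    if "t2 \<noteq> 0" for c z y t1 t2 t3 :: complex
    using that by (simp add: power_divide power_mult_distrib power2_eq_square power_add mult_2)
  have "Y h k w * Y h k (w + h) =
      (Yconst h)\<^sup>2 * zeta h ^ k * (zeta w ^ (2 * k) * ((Theta w)\<^sup>2 / zeta w ^ (2 * k)) / (Theta w)\<^sup>2)"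
    unfolding Y_def zeta_add alg[OF nz(2)] w2h Theta_2h by (rule refl)
  also have "\<dots> = (Yconst h)\<^sup>2 * zeta h ^ k"
    using nz(1) zeta_nz[of w] by simp
  finally show ?thesis .
qed

lemma Y_eq_0:
  assumes "w \<notin> L" "Y h k w = 0"
  shows "w - h \<in> L"
proof -
  have "w + h \<in> L"
    using assms Yconst_nz zeta_nz by (simp add: Y_def Theta_eq_0_iff)
  then have "w + h - 2 * h \<in> L" using twice_in_lattice lattice_diff by blast
  then show ?thesis by (simp add: algebra_simps)
qed

lemma Y_zero: "Y h k h = 0"
  using twice_in_lattice by (simp add: Y_def Theta_eq_0_iff mult_2[symmetric])

text \<open>By the constant product, the double zero at h is the reciprocal of the double pole at 0,
  with leading coefficient the constant divided by 4.\<close>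

lemma Y_zero_order: "(\<lambda>w. Y h k w / (w - h)\<^sup>2) \<midarrow>h\<rightarrow> (Yconst h)\<^sup>2 * zeta h ^ k / 4"
proof -
  have "(\<lambda>w. (w - h)\<^sup>2 * Y h k (w - h)) \<midarrow>h\<rightarrow> 4"
    using LIM_offset[OF Y_pole, of "- h"] by simp
  then have "(\<lambda>w. (Yconst h)\<^sup>2 * zeta h ^ k / ((w - h)\<^sup>2 * Y h k (w - h))) \<midarrow>h\<rightarrow> (Yconst h)\<^sup>2 * zeta h ^ k / 4"
    by (intro tendsto_intros) auto
  moreover have "eventually (\<lambda>w. (Yconst h)\<^sup>2 * zeta h ^ k / ((w - h)\<^sup>2 * Y h k (w - h)) = Y h k w / (w - h)\<^sup>2) (at h)"
    using eventually_not_lattice eventually_not_lattice_shift[of h]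
  proof eventually_elim
    case (elim w)
    have eq: "Y h k (w - h) * Y h k w = (Yconst h)\<^sup>2 * zeta h ^ k"
      using Y_mult_shift[of "w - h"] elim by simp
    then have "Y h k (w - h) \<noteq> 0"
      using Yconst_nz zeta_nz by auto
    then show ?case unfolding eq[symmetric] by simp
  qed
  ultimately show ?thesis using filterlim_cong by force
qed

lemma Y_unique:
  assumes "elliptic L f" "(\<lambda>w. w\<^sup>2 * f w) \<midarrow>0\<rightarrow> 4" "f h = 0" "deriv f h = 0" "w \<notin> L"
  shows "f w = Y h k w"
proof -
  have "f w = 4 / 4 * Y h k w"
    by (rule elliptic_ratio[OF assms(1) Y_elliptic assms(2) Y_pole _ h Y_eq_0 Y_zero Y_zero_order _ assms(3,4,5)])
       (use Yconst_nz zeta_nz in auto)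
  then show ?thesis by simp
qed

end

text \<open>Evenness and the period 2 h give f (2 h - w) = f w, a reflection about h, and this
  reverses the sign of the derivative at h.\<close>

lemma elliptic_even_deriv:
  assumes f: "elliptic L f" and even: "\<And>w. w \<notin> L \<Longrightarrow> f (- w) = f w"
    and h: "h \<notin> L" "2 * h \<in> L"
  shows "deriv f h = 0"
proof -
  have f': "(f has_field_derivative deriv f h) (at h)"
    using f h closed_lattice by (intro holomorphic_derivI[of f "- L"]) (auto simp: elliptic_def)
  have "((\<lambda>w. f (2 * h - w)) has_field_derivative (- deriv f h)) (at h)"
  proof -
    have "((\<lambda>w. 2 * h - w) has_field_derivative -1) (at h)"
      by (auto intro!: derivative_eq_intros)
    moreover have "(f has_field_derivative deriv f h) (at (2 * h - h))"
      using f' by simp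
    ultimately show ?thesis
      using DERIV_chain2[of f "deriv f h" "\<lambda>w. 2 * h - w" h "-1"] by simp
  qed
  moreover have "eventually (\<lambda>w. f (2 * h - w) = f w) (nhds h)"
  proof -
    have "eventually (\<lambda>w. w \<in> - L) (nhds h)"
      using closed_lattice h by (intro eventually_nhds_in_open) auto
    then show ?thesis
    proof eventually_elim
      case (elim w)
      then have "f (- w + 2 * h) = f (- w)"
        using f h lattice_minus_iff unfolding elliptic_def by blast
      then show ?case using even[of w] elim by simp
    qed
  qed
  ultimately have "(f has_field_derivative (- deriv f h)) (at h)"
    by (subst (asm) DERIV_cong_ev[OF refl _ refl])
  then have "- deriv f h = deriv f h" using f' DERIV_unique by blast
  then show ?thesis by simp
qed

subsection \<open>The function with a double zero at the first half period\<close>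

abbreviation X where "X \<equiv> Y (w1 / 2) 0"

lemma half_periods_notin: "w1 / 2 \<notin> L" "w2 / 2 \<notin> L" "(w1 + w2) / 2 \<notin> L" "w2 / 2 - w1 / 2 \<notin> L"
proof -
  have half: "(1 / 2 :: real) \<notin> \<int>"
  proof
    assume "(1 / 2 :: real) \<in> \<int>"
    then obtain n where "1 / 2 = (of_int n :: real)" by (auto elim: Ints_cases)
    then have "(of_int 1 :: real) = of_int (2 * n)" by simp
    then have "1 = 2 * n" using of_int_eq_iff by blast
    then show False by presburger
  qed
  show "w1 / 2 \<notin> L" using comb_in_lattice_iff[of "1/2" 0] half by simp
  show "w2 / 2 \<notin> L" using comb_in_lattice_iff[of 0 "1/2"] half by simp
  show "(w1 + w2) / 2 \<notin> L" using comb_in_lattice_iff[of "1/2" "1/2"] half by (simp add: add_divide_distrib)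
  show "w2 / 2 - w1 / 2 \<notin> L" using comb_in_lattice_iff[of "-1/2" "1/2"] half by (simp add: algebra_simps)
qed

lemma periods_in_lattice: "w1 \<in> L" "w2 \<in> L" "w1 + w2 \<in> L"
  using comb_in_lattice_iff[of 1 0] comb_in_lattice_iff[of 0 1] comb_in_lattice_iff[of 1 1] by simp_all

lemma zeta_half_w1_square: "(zeta (w1 / 2))\<^sup>2 = q ^ 0"
  by (simp add: zeta_half_w1)

lemma zeta_half_w2_square: "(zeta (w2 / 2))\<^sup>2 = q ^ 1"
  using zeta_add[of "w2 / 2" "w2 / 2"] by (simp add: zeta_w2 power2_eq_square)

lemmas X_facts =
  Y_elliptic[OF half_periods_notin(1) zeta_half_w1_square disjI1[OF refl]]
  Y_pole[OF half_periods_notin(1) zeta_half_w1_square disjI1[OF refl]]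
  Y_zero[OF half_periods_notin(1) zeta_half_w1_square disjI1[OF refl]]
  Y_eq_0[OF half_periods_notin(1) zeta_half_w1_square disjI1[OF refl]]

lemmas X_unique = Y_unique[OF half_periods_notin(1) zeta_half_w1_square disjI1[OF refl]]

lemma X_even: "X (- w) = X w"
proof -
  have "Theta (- w + w1 / 2) = - Theta (w - w1 / 2) / zeta (w - w1 / 2)"
    using Theta_minus[of "w - w1 / 2"] by (simp add: algebra_simps)
  moreover have "Theta (w - w1 / 2) = Theta (w + w1 / 2)"
    by (simp add: Theta_def zeta_diff zeta_add zeta_half_w1)
  ultimately show ?thesis
    using zeta_nz by (simp add: Y_def Theta_minus zeta_diff zeta_half_w1 power_divide)
qed

lemma X_deriv: "h \<notin> L \<Longrightarrow> 2 * h \<in> L \<Longrightarrow> deriv X h = 0"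
  by (rule elliptic_even_deriv[OF X_facts(1) X_even])

text \<open>The constant value of X(w) X(w + w1/2). It will be the coefficient b of the curve, but
  it is defined from the basis alone.\<close>

definition B where "B = (2 * of_real pi / w1) ^ 4 * qpoch q q ^ 8 / qpoch q (- q) ^ 8"

lemma Yconst_w1: "(Yconst (w1 / 2))\<^sup>2 = B"
proof -
  have "Theta (w1 / 2) = 2 * (qpoch q (- q))\<^sup>2"
    unfolding Theta_def zeta_half_w1 by (rule thetaS_minus_1[OF norm_q q_nz])
  then have "Yconst (w1 / 2) = (2 * of_real pi * \<i> / w1)\<^sup>2 * qpoch q q ^ 4 / qpoch q (- q) ^ 4"
    by (simp add: Yconst_def power_mult_distrib flip: power_mult)
  then show ?thesis
    by (simp add: B_def power_mult_distrib power_divide flip: power_mult)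
qed

lemma X_mult_shift: "w \<notin> L \<Longrightarrow> w + w1 / 2 \<notin> L \<Longrightarrow> X w * X (w + w1 / 2) = B"
  using Y_mult_shift[OF half_periods_notin(1) zeta_half_w1_square disjI1[OF refl]] Yconst_w1 by simp

lemma X_zero_order: "(\<lambda>w. X w / (w - w1 / 2)\<^sup>2) \<midarrow>w1 / 2\<rightarrow> B / 4"
  using Y_zero_order[OF half_periods_notin(1) zeta_half_w1_square disjI1[OF refl]] Yconst_w1 by simp

lemma elliptic_diff_const: "elliptic L f \<Longrightarrow> elliptic L (\<lambda>w. f w - c)"
  by (auto simp: elliptic_def intro!: holomorphic_intros)

lemma pole_diff_const: "(\<lambda>w. w\<^sup>2 * f w) \<midarrow>0\<rightarrow> (a :: complex) \<Longrightarrow> (\<lambda>w. w\<^sup>2 * (f w - c)) \<midarrow>0\<rightarrow> a"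
proof -
  assume "(\<lambda>w. w\<^sup>2 * f w) \<midarrow>0\<rightarrow> a"
  then have "(\<lambda>w. w\<^sup>2 * f w - w\<^sup>2 * c) \<midarrow>0\<rightarrow> a - 0\<^sup>2 * c"
    by (intro tendsto_intros)
  then show ?thesis by (simp add: ring_distribs)
qed

text \<open>X is even and w2/2 is a half period, so the difference has a double zero there and
  uniqueness identifies it.\<close>

lemma X_diff: "w \<notin> L \<Longrightarrow> X w - X (w2 / 2) = Y (w2 / 2) 1 w"
proof (rule Y_unique[OF half_periods_notin(2) zeta_half_w2_square disjI2[OF refl]])
  show "elliptic L (\<lambda>w. X w - X (w2 / 2))"
    by (rule elliptic_diff_const[OF X_facts(1)])
  show "(\<lambda>w. w\<^sup>2 * (X w - X (w2 / 2))) \<midarrow>0\<rightarrow> 4"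
    by (rule pole_diff_const[OF X_facts(2)])
  have "X field_differentiable at (w2 / 2)"
    using X_facts(1) closed_lattice half_periods_notin
    by (intro holomorphic_on_imp_differentiable_at[of _ "- L"]) (auto simp: elliptic_def)
  then show "deriv (\<lambda>w. X w - X (w2 / 2)) (w2 / 2) = 0"
    using X_deriv[OF half_periods_notin(2)] periods_in_lattice by simp
qed auto

text \<open>\<open>X_diff\<close> is evaluated at the third half period. Here p is a square root of
  q: the theta values at the two half periods are (p; q)^2 and (-p; q)^2, the one at their sum is 2
  (-q; q)^2. Squaring the result replaces p by q and gives 256 = 16^2.\<close>

lemma X_half_periods_diff:
  "(X ((w1 + w2) / 2) - X (w2 / 2))\<^sup>2 =
     256 * q * (2 * of_real pi / w1) ^ 4 * qpoch q q ^ 8 * qpoch q (- q) ^ 16"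
proof -
  define p where "p = zeta (w2 / 2)"
  have p2: "p\<^sup>2 = q" using zeta_half_w2_square by (simp add: p_def)
  have p0: "p \<noteq> 0" by (simp add: p_def zeta_nz)
  have np: "norm p < 1"
  proof (rule ccontr)
    assume "\<not> norm p < 1"
    then have "1 \<le> norm p ^ 2" by (simp add: one_le_power)
    then show False using norm_q p2 by (metis norm_power not_less)
  qed
  have qp: "q / p = p" using p2 p0 by (simp add: power2_eq_square divide_eq_eq)
  have Tp: "Theta (w2 / 2) = (qpoch q p)\<^sup>2"
    by (simp add: Theta_def thetaS_def p_def[symmetric] qp power2_eq_square)
  have zm: "zeta ((w1 + w2) / 2) = - p"
    using zeta_add[of "w1 / 2" "w2 / 2"] by (simp add: add_divide_distrib zeta_half_w1 p_def)
  have Tm: "Theta ((w1 + w2) / 2) = (qpoch q (- p))\<^sup>2"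
    by (simp add: Theta_def thetaS_def zm qp power2_eq_square)
  have "Theta ((w1 + w2) / 2 + w2 / 2) = Theta (w1 / 2 + w2)"
    by (simp add: field_simps)
  also have "\<dots> = 2 * (qpoch q (- q))\<^sup>2"
    using thetaS_minus_1[OF norm_q q_nz] by (simp add: Theta_w2 zeta_half_w1) (simp add: Theta_def zeta_half_w1)
  finally have T2: "Theta ((w1 + w2) / 2 + w2 / 2) = 2 * (qpoch q (- q))\<^sup>2" .
  have e: "qpoch q p * qpoch q (- p) * qpoch q (- q) = 1"
    using qpoch_square_root[OF np] by (simp add: p2)
  then have "qpoch q p * qpoch q (- p) = 1 / qpoch q (- q)"
    by (metis eq_divide_imp mult_zero_right zero_neq_one)
  then have e4: "qpoch q p ^ 4 * qpoch q (- p) ^ 4 = 1 / qpoch q (- q) ^ 4"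
    by (simp flip: power_mult_distrib add: power_divide)
  have alg: "4 * c\<^sup>2 * e ^ 4 / (u\<^sup>2)\<^sup>2 * (- p) ^ 1 * (2 * m\<^sup>2 / v\<^sup>2)\<^sup>2 =
      - 16 * p * c\<^sup>2 * e ^ 4 * m ^ 4 / (u ^ 4 * v ^ 4)" for c e u v m :: complex
    by (simp add: power_divide power_mult_distrib flip: power_mult)
  have alg2: "- 16 * p * c\<^sup>2 * e ^ 4 * m ^ 4 / (1 / m ^ 4) = - 16 * p * c\<^sup>2 * e ^ 4 * m ^ 8" for c e m :: complex
    by (simp flip: power_add)
  have alg3: "(- 16 * p * (c * \<i> / w1)\<^sup>2 * e ^ 4 * m ^ 8)\<^sup>2 = 256 * q * (c / w1) ^ 4 * e ^ 8 * m ^ 16" for c e m :: complex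
    unfolding p2[symmetric] by (simp add: power_mult_distrib power_divide flip: power_mult)
  have "X ((w1 + w2) / 2) - X (w2 / 2) = Y (w2 / 2) 1 ((w1 + w2) / 2)"
    by (rule X_diff[OF half_periods_notin(3)])
  also have "\<dots> = - 16 * p * (2 * of_real pi * \<i> / w1)\<^sup>2 * qpoch q q ^ 4 * qpoch q (- q) ^ 4 /
      (qpoch q p ^ 4 * qpoch q (- p) ^ 4)"
    unfolding Y_def Yconst_def Tp Tm T2 zm by (rule alg)
  also have "\<dots> = - 16 * p * (2 * of_real pi * \<i> / w1)\<^sup>2 * qpoch q q ^ 4 * qpoch q (- q) ^ 8"
    unfolding e4 by (rule alg2)
  finally show ?thesis
    by (simp only: alg3)
qed

end

section \<open>Uniformizations of the curve\<close>

lemma tendsto_eventually_eq_unique: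
  fixes a l m :: complex
  assumes "f \<midarrow>a\<rightarrow> l" "g \<midarrow>a\<rightarrow> m" "eventually (\<lambda>w. f w = g w) (at a)"
  shows "l = m"
  using Lim_transform_eventually[OF assms(1,3)] assms(2) by (rule LIM_unique)

context period_basis
begin

context
  fixes a b :: complex and \<phi> :: "complex \<Rightarrow> complex \<times> complex"
  assumes unif: "uniformization a b \<phi>" and lat: "period_lattice a b = L"
begin

definition ux where "ux = fst \<circ> \<phi>"
definition uy where "uy = snd \<circ> \<phi>"

lemma open_compl: "open (- L)"
  using closed_lattice by auto

lemma ux_holomorphic: "ux holomorphic_on - L" and uy_holomorphic: "uy holomorphic_on - L"
  and phi_eq_iff: "w \<notin> L \<Longrightarrow> w' \<notin> L \<Longrightarrow> \<phi> w = \<phi> w' \<longleftrightarrow> w - w' \<in> L"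
  and ux_pole: "is_pole ux 0"
  and phi_surj: "(x, y) \<in> affine_curve a b \<Longrightarrow> \<exists>w. w \<notin> L \<and> ux w = x \<and> uy w = y"
  and curve_eq: "w \<notin> L \<Longrightarrow> (uy w)\<^sup>2 = ux w * ((ux w)\<^sup>2 + a * ux w + b)"
  and form_eq: "w \<notin> L \<Longrightarrow> dx_over_y a b (ux w, uy w) (deriv ux w, deriv uy w) = 1"
proof -
  note u = unif[unfolded uniformization_def lat, folded ux_def uy_def]
  show "ux holomorphic_on - L" "uy holomorphic_on - L" "is_pole ux 0"
    using u lattice_0 by auto
  show "w \<notin> L \<Longrightarrow> w' \<notin> L \<Longrightarrow> \<phi> w = \<phi> w' \<longleftrightarrow> w - w' \<in> L"
    using u by auto
  have phi: "\<phi> w = (ux w, uy w)" for w by (simp add: ux_def uy_def)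
  have im: "\<phi> ` (- L) = affine_curve a b" using u by simp
  show "(uy w)\<^sup>2 = ux w * ((ux w)\<^sup>2 + a * ux w + b)" if "w \<notin> L"
  proof -
    have "\<phi> w \<in> affine_curve a b" using im that by blast
    then show ?thesis by (simp add: phi affine_curve_def)
  qed
  show "\<exists>w. w \<notin> L \<and> ux w = x \<and> uy w = y" if "(x, y) \<in> affine_curve a b"
  proof -
    from that obtain w where "w \<in> - L" "\<phi> w = (x, y)" unfolding im[symmetric] by (metis imageE)
    then show ?thesis by (auto simp: phi)
  qed
  show "dx_over_y a b (ux w, uy w) (deriv ux w, deriv uy w) = 1" if "w \<notin> L"
    using u that by (simp add: phi)
qed

lemma ux_has_deriv: "w \<notin> L \<Longrightarrow> (ux has_field_derivative deriv ux w) (at w)"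
  and uy_has_deriv: "w \<notin> L \<Longrightarrow> (uy has_field_derivative deriv uy w) (at w)"
  using ux_holomorphic uy_holomorphic open_compl holomorphic_derivI by auto

lemma deriv_relation:
  assumes "w \<notin> L"
  shows "2 * uy w * deriv uy w = (3 * (ux w)\<^sup>2 + 2 * a * ux w + b) * deriv ux w"
proof (rule DERIV_unique)
  show "((\<lambda>w. (uy w)\<^sup>2) has_field_derivative 2 * uy w * deriv uy w) (at w)"
    using uy_has_deriv[OF assms] by (auto intro!: derivative_eq_intros)
  have "((\<lambda>w. ux w * ((ux w)\<^sup>2 + a * ux w + b)) has_field_derivative
      (3 * (ux w)\<^sup>2 + 2 * a * ux w + b) * deriv ux w) (at w)"
    using ux_has_deriv[OF assms]
    by (auto intro!: derivative_eq_intros simp: power2_eq_square algebra_simps)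
  moreover have "eventually (\<lambda>v. (uy v)\<^sup>2 = ux v * ((ux v)\<^sup>2 + a * ux v + b)) (nhds w)"
    using eventually_nhds_in_open[OF open_compl, of w] assms
    by (auto elim!: eventually_mono simp: curve_eq)
  ultimately show "((\<lambda>w. (uy w)\<^sup>2) has_field_derivative
      (3 * (ux w)\<^sup>2 + 2 * a * ux w + b) * deriv ux w) (at w)"
    by (subst DERIV_cong_ev[OF refl _ refl])
qed

lemma deriv_ux: "deriv ux w = uy w"
  and deriv_uy: "deriv uy w = (3 * (ux w)\<^sup>2 + 2 * a * ux w + b) / 2"
  if w: "w \<notin> L"
proof -
  note rel = deriv_relation[OF w] and form = form_eq[OF w]
  have "deriv ux w = uy w \<and> deriv uy w = (3 * (ux w)\<^sup>2 + 2 * a * ux w + b) / 2"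
  proof (cases "uy w = 0")
    case True
    then have e: "2 * deriv uy w / (3 * (ux w)\<^sup>2 + 2 * a * ux w + b) = 1"
      using form by (simp add: dx_over_y_def)
    \<comment> \<open>A zero denominator would make the quotient 0 rather than 1, since division by
      zero yields 0.\<close>
    then have nz: "3 * (ux w)\<^sup>2 + 2 * a * ux w + b \<noteq> 0" by auto
    with e have "deriv uy w * 2 = 3 * (ux w)\<^sup>2 + 2 * a * ux w + b" by (simp add: divide_eq_eq mult.commute)
    moreover have "deriv ux w = 0" using rel nz True by simp
    ultimately show ?thesis using True by (simp add: eq_divide_eq)
  next
    case False
    then have "deriv ux w = uy w" using form by (simp add: dx_over_y_def divide_eq_eq)
    moreover from this have "uy w * (deriv uy w * 2) = uy w * (3 * (ux w)\<^sup>2 + 2 * a * ux w + b)"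
      using rel by (simp add: mult_ac)
    ultimately show ?thesis using False by (simp add: eq_divide_eq)
  qed
  then show "deriv ux w = uy w" "deriv uy w = (3 * (ux w)\<^sup>2 + 2 * a * ux w + b) / 2" by auto
qed

lemma deriv_deriv_ux:
  assumes "w \<notin> L"
  shows "deriv (deriv ux) w = (3 * (ux w)\<^sup>2 + 2 * a * ux w + b) / 2"
proof -
  have "eventually (\<lambda>v. deriv ux v = uy v) (nhds w)"
    using eventually_nhds_in_open[OF open_compl, of w] assms
    by (auto elim!: eventually_mono simp: deriv_ux)
  then have "deriv (deriv ux) w = deriv uy w" by (rule deriv_cong_ev) simp
  then show ?thesis using deriv_uy[OF assms] by simp
qed

lemma ux_elliptic: "elliptic L ux"
proof -
  have "ux (w + l) = ux w" if "w \<notin> L" "l \<in> L" for w l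
    using phi_eq_iff[of "w + l" w] that lattice_add_iff[of l w] by (simp add: ux_def)
  then show ?thesis using ux_holomorphic by (auto simp: elliptic_def)
qed

text \<open>
  The reciprocal u = 1/x satisfies u'' = 1/2 + a u + 3/2 b u^2, so it is w^2/4 to leading order at
  the pole.
\<close>

lemma ux_double_pole: "(\<lambda>w. w\<^sup>2 * ux w) \<midarrow>0\<rightarrow> 4"
proof -
  have "eventually (\<lambda>w. ux w \<noteq> 0) (at 0)"
    using ux_pole by (rule non_zero_neighbour_pole)
  with eventually_not_lattice[of 0] have "eventually (\<lambda>w. w \<notin> L \<and> ux w \<noteq> 0) (at 0)"
    by (rule eventually_conj)
  then obtain d where d: "d > 0" and dw: "\<And>w. w \<noteq> 0 \<Longrightarrow> dist w 0 < d \<Longrightarrow> w \<notin> L \<and> ux w \<noteq> 0"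
    unfolding eventually_at by blast
  define S where "S = ball (0::complex) d"
  have S: "open S" "0 \<in> S" using d by (auto simp: S_def)
  have SL: "w \<notin> L" "ux w \<noteq> 0" if "w \<in> S" "w \<noteq> 0" for w
    using dw[of w] that by (auto simp: S_def)
  define u where "u w = (if w = 0 then 0 else inverse (ux w))" for w
  have u: "u holomorphic_on S"
    unfolding u_def using SL
    by (intro is_pole_inverse_holomorphic S ux_pole holomorphic_on_subset[OF ux_holomorphic]) auto
  have nhdsS: "eventually (\<lambda>v. v \<in> S - {0}) (nhds w)" if "w \<in> S - {0}" for w
    using that S(1) by (intro eventually_nhds_in_open) auto
  have xu: "ux w * u w = 1" if "w \<in> S - {0}" for w
    using SL that by (simp add: u_def)
  have du: "deriv u w = - uy w * (u w)\<^sup>2" if w: "w \<in> S - {0}" for w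
  proof -
    have wL: "w \<notin> L" "ux w \<noteq> 0" using SL w by auto
    have "((\<lambda>w. inverse (ux w)) has_field_derivative - (inverse (ux w) * uy w * inverse (ux w))) (at w)"
      using DERIV_inverse'[OF ux_has_deriv[OF wL(1)] wL(2)] deriv_ux[OF wL(1)] by simp
    moreover have "eventually (\<lambda>v. u v = inverse (ux v)) (nhds w)"
      using nhdsS[OF w] by eventually_elim (auto simp: u_def)
    ultimately have "(u has_field_derivative - (inverse (ux w) * uy w * inverse (ux w))) (at w)"
      by (subst DERIV_cong_ev[OF refl _ refl])
    then show ?thesis
      using w by (simp add: DERIV_imp_deriv u_def power2_eq_square mult_ac)
  qed
  \<comment> \<open>This first-order equation only yields u'(0) = 0, its right side being 0 at u =
    0. The leading coefficient comes from the second-order equation \<open>ddu\<close>, with u''(0)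
    = 1/2.\<close>
  have du2: "(deriv u w)\<^sup>2 = u w + a * (u w)\<^sup>2 + b * (u w) ^ 3" if w: "w \<in> S - {0}" for w
  proof -
    have wL: "w \<notin> L" "ux w \<noteq> 0" using SL w by auto
    have "(deriv u w)\<^sup>2 = (uy w)\<^sup>2 * (u w) ^ 4"
      by (simp add: du[OF w] power_mult_distrib flip: power_mult)
    also have "\<dots> = (ux w * ((ux w)\<^sup>2 + a * ux w + b)) * (u w) ^ 4"
      by (simp add: curve_eq[OF wL(1)])
    also have "\<dots> = u w + a * (u w)\<^sup>2 + b * (u w) ^ 3"
    proof -
      have "(ux w * ((ux w)\<^sup>2 + a * ux w + b)) * (u w) ^ 4 =
          (ux w * u w) ^ 3 * u w + a * (ux w * u w)\<^sup>2 * (u w)\<^sup>2 + b * (ux w * u w) * (u w) ^ 3"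
        by (simp add: algebra_simps power2_eq_square power3_eq_cube power4_eq_xxxx)
      then show ?thesis by (simp add: xu[OF w])
    qed
    finally show ?thesis .
  qed
  have ddu: "deriv (deriv u) w = 1 / 2 + a * u w + 3 / 2 * b * (u w)\<^sup>2" if w: "w \<in> S - {0}" for w
  proof -
    have wL: "w \<notin> L" "ux w \<noteq> 0" using SL w by auto
    have uw: "(u has_field_derivative deriv u w) (at w)"
      using holomorphic_derivI[OF u S(1)] w by auto
    have "((\<lambda>w. - uy w * (u w)\<^sup>2) has_field_derivative
        - deriv uy w * (u w)\<^sup>2 - 2 * uy w * u w * deriv u w) (at w)"
      using uw uy_has_deriv[OF wL(1)] by (auto intro!: derivative_eq_intros simp: algebra_simps)
    moreover have "eventually (\<lambda>v. deriv u v = - uy v * (u v)\<^sup>2) (nhds w)"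
      using nhdsS[OF w] by eventually_elim (rule du)
    ultimately have "(deriv u has_field_derivative
        - deriv uy w * (u w)\<^sup>2 - 2 * uy w * u w * deriv u w) (at w)"
      by (subst DERIV_cong_ev[OF refl _ refl])
    then have "deriv (deriv u) w = - deriv uy w * (u w)\<^sup>2 - 2 * uy w * u w * deriv u w"
      by (rule DERIV_imp_deriv)
    also have "\<dots> = - ((3 * (ux w)\<^sup>2 + 2 * a * ux w + b) / 2) * (u w)\<^sup>2 + 2 * (uy w)\<^sup>2 * (u w) ^ 3"
      unfolding du[OF w] deriv_uy[OF wL(1)] by (simp add: power2_eq_square power3_eq_cube)
    also have "\<dots> = - ((3 * (ux w)\<^sup>2 + 2 * a * ux w + b) / 2) * (u w)\<^sup>2
        + 2 * (ux w * ((ux w)\<^sup>2 + a * ux w + b)) * (u w) ^ 3"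
      by (simp only: curve_eq[OF wL(1)])
    also have "\<dots> = 1 / 2 + a * u w + 3 / 2 * b * (u w)\<^sup>2"
    proof -
      have "- ((3 * (ux w)\<^sup>2 + 2 * a * ux w + b) / 2) * (u w)\<^sup>2
          + 2 * (ux w * ((ux w)\<^sup>2 + a * ux w + b)) * (u w) ^ 3 =
          - (3 / 2) * (ux w * u w)\<^sup>2 - a * (ux w * u w) * u w - b / 2 * (u w)\<^sup>2
          + 2 * (ux w * u w) ^ 3 + 2 * a * (ux w * u w)\<^sup>2 * u w + 2 * b * (ux w * u w) * (u w)\<^sup>2"
        by (simp add: algebra_simps power2_eq_square power3_eq_cube add_divide_distrib)
      then show ?thesis unfolding xu[OF w] by (simp add: algebra_simps)
    qed
    finally show ?thesis .
  qed
  have cont: "f \<midarrow>0\<rightarrow> f 0" if "f holomorphic_on S" for f :: "complex \<Rightarrow> complex"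
    using holomorphic_on_imp_continuous_on[OF that] S
    by (meson continuous_on_eq_continuous_at isContD)
  have evS: "eventually (\<lambda>w. w \<in> S - {0}) (at 0)"
    using eventually_at_in_open[OF S] .
  have u0: "u 0 = 0" by (simp add: u_def)
  have hol1: "deriv u holomorphic_on S" and hol2: "deriv (deriv u) holomorphic_on S"
    using u S(1) by (auto intro!: holomorphic_deriv)
  have "(\<lambda>w. (deriv u w)\<^sup>2) \<midarrow>0\<rightarrow> (deriv u 0)\<^sup>2"
    by (intro tendsto_power cont hol1)
  moreover have "(\<lambda>w. u w + a * (u w)\<^sup>2 + b * (u w) ^ 3) \<midarrow>0\<rightarrow> u 0 + a * (u 0)\<^sup>2 + b * (u 0) ^ 3"
    by (intro tendsto_add tendsto_mult tendsto_power tendsto_const cont u)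
  moreover have "eventually (\<lambda>w. (deriv u w)\<^sup>2 = u w + a * (u w)\<^sup>2 + b * (u w) ^ 3) (at 0)"
    using evS by eventually_elim (rule du2)
  ultimately have "(deriv u 0)\<^sup>2 = u 0 + a * (u 0)\<^sup>2 + b * (u 0) ^ 3"
    by (rule tendsto_eventually_eq_unique)
  then have u1: "deriv u 0 = 0" by (simp add: u0)
  have "deriv (deriv u) \<midarrow>0\<rightarrow> deriv (deriv u) 0"
    by (intro cont hol2)
  moreover have "(\<lambda>w. 1 / 2 + a * u w + 3 / 2 * b * (u w)\<^sup>2) \<midarrow>0\<rightarrow> 1 / 2 + a * u 0 + 3 / 2 * b * (u 0)\<^sup>2"
    by (intro tendsto_add tendsto_mult tendsto_power tendsto_const cont u)
  moreover have "eventually (\<lambda>w. deriv (deriv u) w = 1 / 2 + a * u w + 3 / 2 * b * (u w)\<^sup>2) (at 0)"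
    using evS by eventually_elim (rule ddu)
  ultimately have "deriv (deriv u) 0 = 1 / 2 + a * u 0 + 3 / 2 * b * (u 0)\<^sup>2"
    by (rule tendsto_eventually_eq_unique)
  then have u2: "deriv (deriv u) 0 = 1 / 2" by (simp add: u0)
  have "(\<lambda>w. u w / (w - 0)\<^sup>2) \<midarrow>0\<rightarrow> deriv (deriv u) 0 / 2"
    by (rule second_order_zero_tendsto[OF u S u0 u1])
  then have "(\<lambda>w. inverse (u w / w\<^sup>2)) \<midarrow>0\<rightarrow> inverse (1 / 4)"
    by (intro tendsto_inverse) (auto simp: u2)
  moreover have "eventually (\<lambda>w. inverse (u w / w\<^sup>2) = w\<^sup>2 * ux w) (at 0)"
    using evS by eventually_elim (simp add: u_def divide_inverse)
  ultimately have "(\<lambda>w. w\<^sup>2 * ux w) \<midarrow>0\<rightarrow> inverse (1 / 4)"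
    by (rule Lim_transform_eventually)
  then show ?thesis by simp
qed

text \<open>At (0,0) one has x' = y = 0, and x'' = (3 x^2 + 2 a x + b)/2 reduces to b/2.\<close>

lemma ux_zero_order:
  assumes "h \<notin> L" "\<phi> h = (0, 0)"
  shows "(\<lambda>w. ux w / (w - h)\<^sup>2) \<midarrow>h\<rightarrow> b / 4" "ux h = 0" "deriv ux h = 0"
proof -
  show h: "ux h = 0" "deriv ux h = 0"
    using assms(2) deriv_ux[OF assms(1)] by (simp_all add: ux_def uy_def)
  show "(\<lambda>w. ux w / (w - h)\<^sup>2) \<midarrow>h\<rightarrow> b / 4"
    using second_order_zero_tendsto[OF ux_holomorphic open_compl _ h] assms(1)
    by (simp add: deriv_deriv_ux h)
qed

lemma ux_eq_0:
  assumes "h \<notin> L" "\<phi> h = (0, 0)" "w \<notin> L" "ux w = 0"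
  shows "w - h \<in> L"
proof -
  have "uy w = 0" using curve_eq[OF assms(3)] assms(4) by simp
  then have "\<phi> w = \<phi> h" using assms(2,4) by (simp add: ux_def uy_def prod_eq_iff)
  then show ?thesis using phi_eq_iff assms by blast
qed

section \<open>The coefficients of the curve from the marked half period\<close>

context
  assumes half: "\<phi> (w1 / 2) = (0, 0)"
begin

lemma ux_eq_X: "w \<notin> L \<Longrightarrow> ux w = X w"
  using X_unique ux_elliptic ux_double_pole ux_zero_order(2,3)[OF half_periods_notin(1) half]
  by blast

text \<open>The leading coefficient of the double zero at w1/2 is computed twice: b/4 by the
  differential equation, B/4 by the product identity for \<open>X\<close>.\<close>

lemma b_eq_B: "b = B"
proof -
  have "(\<lambda>w. ux w / (w - w1 / 2)\<^sup>2) \<midarrow>w1 / 2\<rightarrow> b / 4"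
    by (rule ux_zero_order(1)[OF half_periods_notin(1) half])
  moreover have "eventually (\<lambda>w. ux w / (w - w1 / 2)\<^sup>2 = X w / (w - w1 / 2)\<^sup>2) (at (w1 / 2))"
    using eventually_not_lattice by eventually_elim (simp add: ux_eq_X)
  ultimately have "(\<lambda>w. X w / (w - w1 / 2)\<^sup>2) \<midarrow>w1 / 2\<rightarrow> b / 4"
    by (rule Lim_transform_eventually)
  then have "b / 4 = B / 4" using X_zero_order LIM_unique by blast
  then show ?thesis by simp
qed

lemma uy_half_period:
  assumes "h \<notin> L" "2 * h \<in> L"
  shows "uy h = 0"
proof -
  have "eventually (\<lambda>w. ux w = X w) (nhds h)"
    using eventually_nhds_in_open[OF open_compl, of h] assms
    by (auto elim!: eventually_mono simp: ux_eq_X)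
  then have "deriv ux h = deriv X h" by (rule deriv_cong_ev) simp
  then show ?thesis using deriv_ux[OF assms(1)] X_deriv[OF assms] by simp
qed

lemma ux_half_period:
  assumes "h \<notin> L" "2 * h \<in> L" "h - w1 / 2 \<notin> L"
  shows "(ux h)\<^sup>2 + a * ux h + b = 0"
proof -
  have "ux h * ((ux h)\<^sup>2 + a * ux h + b) = 0"
    using curve_eq[OF assms(1)] uy_half_period[OF assms(1,2)] by simp
  moreover have "ux h \<noteq> 0"
    using ux_eq_0[OF half_periods_notin(1) half assms(1)] assms(3) by blast
  ultimately show ?thesis by simp
qed

lemma discriminant_eq: "a\<^sup>2 - 4 * b = (X ((w1 + w2) / 2) - X (w2 / 2))\<^sup>2"
proof -
  define r2 r3 where "r2 = ux (w2 / 2)" and "r3 = ux ((w1 + w2) / 2)"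
  have h1: "(w1 + w2) / 2 - w2 / 2 = w1 / 2" and h2: "(w1 + w2) / 2 - w1 / 2 = w2 / 2"
    by (simp_all add: field_simps)
  have dbl: "2 * (v / 2) = v" for v :: complex by simp
  note half_facts = half_periods_notin periods_in_lattice
  have 2: "r2\<^sup>2 + a * r2 + b = 0" and 3: "r3\<^sup>2 + a * r3 + b = 0"
    unfolding r2_def r3_def
    by (rule ux_half_period; simp only: dbl h2 half_facts not_False_eq_True)+
  \<comment> \<open>Both values are roots of the same quadratic; Vieta's formulas apply only once
    they are known to differ. Equal values would mean equal points, as y vanishes at both, against
    injectivity modulo L.\<close>
  have "r2 \<noteq> r3"
  proof
    assume "r2 = r3"
    moreover have "uy (w2 / 2) = 0" "uy ((w1 + w2) / 2) = 0"
      by (rule uy_half_period; simp only: dbl half_facts not_False_eq_True)+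
    ultimately have "\<phi> ((w1 + w2) / 2) = \<phi> (w2 / 2)"
      by (simp add: r2_def r3_def ux_def uy_def prod_eq_iff)
    then have "w1 / 2 \<in> L"
      using phi_eq_iff[of "(w1 + w2) / 2" "w2 / 2"] half_periods_notin h1 by simp
    then show False using half_periods_notin by simp
  qed
  have "(r2 - r3) * (r2 + r3 + a) = 0"
  proof -
    have "(r2 - r3) * (r2 + r3 + a) = (r2\<^sup>2 + a * r2 + b) - (r3\<^sup>2 + a * r3 + b)"
      by (simp add: algebra_simps power2_eq_square)
    then show ?thesis unfolding 2 3 by simp
  qed
  with \<open>r2 \<noteq> r3\<close> have "r2 + r3 + a = 0" by simp
  then have a: "a = - (r2 + r3)" by (rule add_eq_0_iff[THEN iffD1])
  have "b = - (r2\<^sup>2 + a * r2)" using 2 by (rule add_eq_0_iff[THEN iffD1])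
  then have "b = r2 * r3" by (simp add: a power2_eq_square algebra_simps)
  then have "a\<^sup>2 - 4 * b = (r3 - r2)\<^sup>2" by (simp add: a power2_eq_square algebra_simps)
  then show ?thesis
    using half_periods_notin by (simp add: r2_def r3_def ux_eq_X)
qed

end

end

text \<open>
  Two uniformizations with the same invariant differential agree at the distinguished point:
  otherwise x would be changed by a nonzero additive constant, which the equation of the curve
  does not allow.
\<close>

lemma uniformization_unique:
  assumes unif: "uniformization a b \<phi>" "uniformization a b \<psi>" and lat: "period_lattice a b = L"
    and b: "b \<noteq> 0" and half: "\<phi> (w1 / 2) = (0, 0)"
    and h: "h \<notin> L" "2 * h \<in> L" "\<psi> h = (0, 0)"
  shows "h - w1 / 2 \<in> L"
proof -
  define x x' where "x = fst \<circ> \<phi>" and "x' = fst \<circ> \<psi>"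
  have x: "x = ux \<phi>" "x' = ux \<psi>" by (simp_all add: ux_def[OF unif(1) lat] ux_def[OF unif(2) lat] x_def x'_def)
  note A = unif(1) lat and A' = unif(2) lat
  define r where "r = x h"
  \<comment> \<open>Since x' has the double zero at h, and x - r has one there too because y
    vanishes at half periods, Liouville's theorem gives equality. Here x' is the coordinate of
    \<open>\<psi>\<close>, not a derivative.\<close>
  have eq: "x w - r = x' w" if "w \<notin> L" for w
  proof -
    have "x w - r = 4 / 4 * x' w"
    proof (rule elliptic_ratio[where f = "\<lambda>w. x w - r" and g = x' and h = h and \<gamma> = "b / 4"])
      show "elliptic L (\<lambda>w. x w - r)" "elliptic L x'"
        unfolding x using ux_elliptic[OF A] ux_elliptic[OF A'] elliptic_diff_const by auto
      show "(\<lambda>w. w\<^sup>2 * (x w - r)) \<midarrow>0\<rightarrow> 4" "(\<lambda>w. w\<^sup>2 * x' w) \<midarrow>0\<rightarrow> 4"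
        unfolding x using ux_double_pole[OF A] ux_double_pole[OF A'] pole_diff_const by auto
      show "(\<lambda>w. x' w / (w - h)\<^sup>2) \<midarrow>h\<rightarrow> b / 4" "x' h = 0"
        unfolding x using ux_zero_order[OF A' h(1,3)] by auto
      show "w - h \<in> L" if "w \<notin> L" "x' w = 0" for w
        using ux_eq_0[OF A' h(1,3)] that x by auto
      have "(x has_field_derivative deriv x h) (at h)"
        unfolding x by (rule ux_has_deriv[OF A h(1)])
      moreover have "deriv x h = 0"
        unfolding x using deriv_ux[OF A h(1)] uy_half_period[OF A half h(1,2)] by simp
      ultimately have "((\<lambda>w. x w - r) has_field_derivative 0) (at h)"
        by (auto intro!: derivative_eq_intros)
      then show "deriv (\<lambda>w. x w - r) h = 0" by (rule DERIV_imp_deriv)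
    qed (use that h b r_def in auto)
    then show ?thesis by simp
  qed
  \<comment> \<open>The two coordinates differ by a constant, so their derivatives, the
    y-coordinates, agree and so do the two values of y^2. Surjectivity of x makes this hold for
    every t.\<close>
  have cubic: "t * (t\<^sup>2 + a * t + b) = (t - r) * ((t - r)\<^sup>2 + a * (t - r) + b)" for t
  proof -
    obtain w where w: "w \<notin> L" "x w = t"
    proof -
      have "(t, csqrt (t * (t\<^sup>2 + a * t + b))) \<in> affine_curve a b"
        by (simp add: affine_curve_def)
      then show ?thesis using phi_surj[OF A] that x by metis
    qed
    have "deriv x w = deriv x' w"
    proof -
      have "deriv x' w = deriv (\<lambda>w. x w - r) w"
      proof (rule deriv_cong_ev)
        show "eventually (\<lambda>v. x' v = x v - r) (nhds w)"
          using eventually_nhds_in_open[OF open_compl[OF A], of w] w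
          by (auto elim!: eventually_mono simp: eq)
      qed simp
      also have "\<dots> = deriv x w"
        using ux_has_deriv[OF A w(1)] unfolding x[symmetric]
        by (intro DERIV_imp_deriv) (auto intro!: derivative_eq_intros)
      finally show ?thesis by simp
    qed
    then have "(deriv x w)\<^sup>2 = (deriv x' w)\<^sup>2" by simp
    then show ?thesis
      unfolding x deriv_ux[OF A w(1)] deriv_ux[OF A' w(1)] curve_eq[OF A w(1)] curve_eq[OF A' w(1)]
      unfolding x[symmetric] w(2) eq[OF w(1), symmetric] .
  qed
  have "r = 0"
  proof (rule ccontr)
    assume r: "r \<noteq> 0"
    \<comment> \<open>The cubic is invariant under translation by r. The evaluations at 0, r and 2 r
      make -r, r and 2 r roots of the same quadratic, which is impossible for r nonzero.\<close>
    have "r\<^sup>2 - a * r + b = 0" using cubic[of 0] r by simp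
    moreover have 1: "r\<^sup>2 + a * r + b = 0" using cubic[of r] r by simp
    moreover have "(2 * r)\<^sup>2 + a * (2 * r) + b = 0"
    proof -
      have "2 * r - r = r" by simp
      then have "2 * r * ((2 * r)\<^sup>2 + a * (2 * r) + b) = r * (r\<^sup>2 + a * r + b)"
        using cubic[of "2 * r"] by (simp only:)
      then show ?thesis using r 1 by simp
    qed
    ultimately have "6 * r\<^sup>2 = 0" by algebra
    then show False using r by simp
  qed
  then have "ux \<phi> h = 0" by (simp add: r_def x)
  then show ?thesis
    using ux_eq_0[OF A half_periods_notin(1) half h(1)] by simp
qed

end

section \<open>Eta quotients\<close>

lemma dedekind_eta_qpoch:
  "dedekind_eta \<tau> = exp (2 * of_real pi * \<i> * \<tau> / 24) *
     qpoch (exp (2 * of_real pi * \<i> * \<tau>)) (exp (2 * of_real pi * \<i> * \<tau>))"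
proof -
  have "exp (2 * of_real pi * \<i> * of_nat (Suc n) * \<tau>) =
      exp (2 * of_real pi * \<i> * \<tau>) * exp (2 * of_real pi * \<i> * \<tau>) ^ n" for n
    by (simp add: exp_of_nat_mult[symmetric] exp_add[symmetric] algebra_simps)
  then show ?thesis by (simp add: dedekind_eta_def qpoch_def)
qed

context period_basis
begin

lemma eta_w: "dedekind_eta (w2 / w1) = exp (2 * of_real pi * \<i> * (w2 / w1) / 24) * qpoch q q"
  unfolding dedekind_eta_qpoch q_def by (rule refl)

text \<open>(q^2; q^2) = (q; q) (-q; q) brings the value at twice the argument back to base q, so
  that the quotients keep only (-q; q) and (q; q).\<close>

lemma eta_2w: "dedekind_eta (2 * (w2 / w1)) =
    (exp (2 * of_real pi * \<i> * (w2 / w1) / 24))\<^sup>2 * (qpoch q q * qpoch q (- q))"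
proof -
  have 1: "exp (2 * of_real pi * \<i> * (2 * (w2 / w1))) = q\<^sup>2"
    unfolding q_def exp_double[symmetric] by (simp add: mult_ac)
  have 2: "exp (2 * of_real pi * \<i> * (2 * (w2 / w1)) / 24) = (exp (2 * of_real pi * \<i> * (w2 / w1) / 24))\<^sup>2"
    unfolding exp_double[symmetric] by (simp add: mult_ac)
  show ?thesis
    unfolding dedekind_eta_qpoch[of "2 * (w2 / w1)"] 1 2 qpoch_q_euler[OF norm_q] by (rule refl)
qed

lemma exp_24: "exp (2 * of_real pi * \<i> * (w2 / w1) / 24) ^ 24 = q"
  unfolding q_def exp_of_nat_mult[symmetric] by (simp add: mult_ac)

lemma eta_quotient_24:
  "dedekind_eta (2 * (w2 / w1)) ^ 24 / dedekind_eta (w2 / w1) ^ 24 = q * qpoch q (- q) ^ 24"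
proof -
  have alg: "(e\<^sup>2 * (u * v)) ^ 24 / (e * u) ^ 24 = e ^ 24 * v ^ 24" if "u \<noteq> 0" "e \<noteq> 0" for e u v :: complex
  proof -
    have "(e\<^sup>2 * (u * v)) ^ 24 = (e * u) ^ 24 * (e ^ 24 * v ^ 24)"
      by (simp only: power2_eq_square power_mult_distrib mult_ac)
    then show ?thesis using that by simp
  qed
  show ?thesis
    unfolding eta_w eta_2w using alg[OF qpoch_minus_nz(2)[OF norm_q] exp_not_eq_zero] exp_24 by simp
qed

lemma eta_quotient_8:
  "dedekind_eta (2 * (w2 / w1)) ^ 8 / dedekind_eta (w2 / w1) ^ 16 = qpoch q (- q) ^ 8 / qpoch q q ^ 8"
proof -
  have alg: "(e\<^sup>2 * (u * v)) ^ 8 / (e * u) ^ 16 = v ^ 8 / u ^ 8" if "u \<noteq> 0" "e \<noteq> 0" for e u v :: complex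
  proof -
    have "(e\<^sup>2 * (u * v)) ^ 8 = e ^ 16 * u ^ 8 * v ^ 8" "(e * u) ^ 16 = e ^ 16 * u ^ 8 * u ^ 8"
      by (simp_all add: power_mult_distrib flip: power_mult power_add)
    then show ?thesis using that by simp
  qed
  show ?thesis
    unfolding eta_w eta_2w using alg[OF qpoch_minus_nz(2)[OF norm_q] exp_not_eq_zero] by simp
qed

lemma eta_quotient_B:
  "dedekind_eta (2 * (w2 / w1)) ^ 8 / dedekind_eta (w2 / w1) ^ 16 = (2 * of_real pi / w1) ^ 4 * (1 / B)"
proof -
  have "(2 * of_real pi / w1) ^ 4 \<noteq> 0" using w1_nz by simp
  then show ?thesis unfolding eta_quotient_8 B_def by simp
qed

text \<open>The right side involves only \<open>X\<close>, hence only the lattice and the class of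
  w1/2 besides the labelling of the other two half periods. No curve occurs, so the formula can be
  applied to any basis of the lattice.\<close>

lemma eta_quotient_diff:
  "dedekind_eta (2 * (w2 / w1)) ^ 24 / dedekind_eta (w2 / w1) ^ 24 =
     (X ((w1 + w2) / 2) - X (w2 / 2))\<^sup>2 / (2 ^ 8 * B)"
proof -
  have "q * m ^ 3 = 256 * q * c * l * m ^ 2 / (2 ^ 8 * (c * l / m))"
    if "l \<noteq> 0" "m \<noteq> 0" "c \<noteq> 0" for l m c :: complex
    using that by (simp add: field_simps power2_eq_square power3_eq_cube)
  from this[of "u ^ 8" "v ^ 8" for u v] have alg:
    "q * v ^ 24 = 256 * q * c * u ^ 8 * v ^ 16 / (2 ^ 8 * (c * u ^ 8 / v ^ 8))"
    if "u \<noteq> 0" "v \<noteq> 0" "c \<noteq> 0" for u v c :: complex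
    using that by (simp flip: power_mult)
  show ?thesis
    unfolding eta_quotient_24 X_half_periods_diff B_def
    using w1_nz qpoch_minus_nz[OF norm_q] by (intro alg) auto
qed

text \<open>The new basis (v1, v2) is the image of (w1, w2) under the matrix X. It spans the same
  lattice and v1/2 = w1/2 + v2, so it defines the same function \<open>X\<close> and the same
  \<open>B\<close>; only the explicit factor w1^(-4) becomes v1^(-4).\<close>

lemma X_transform:
  "dedekind_eta (2 * ((w2 - w1) / (2 * w2 - w1))) ^ 8 / dedekind_eta ((w2 - w1) / (2 * w2 - w1)) ^ 16
     = (2 * of_real pi / (2 * w2 - w1)) ^ 4 * (1 / B)" (is ?eta8)
  "dedekind_eta (2 * ((w2 - w1) / (2 * w2 - w1))) ^ 24 / dedekind_eta ((w2 - w1) / (2 * w2 - w1)) ^ 24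
     = dedekind_eta (2 * (w2 / w1)) ^ 24 / dedekind_eta (w2 / w1) ^ 24" (is ?eta24)
proof -
  define v1 v2 where "v1 = 2 * w2 - w1" and "v2 = w2 - w1"
  have "Im (v2 / v1) > 0"
  proof -
    have "v2 / v1 = (w2 / w1 - 1) / (2 * (w2 / w1) - 1)"
      using w1_nz by (simp add: v1_def v2_def divide_simps)
    then show ?thesis using Im_moebius_pos[OF Im_pos, of 1 "-1" "-1" 2] by simp
  qed
  then interpret V: period_basis v1 v2 by unfold_locales
  have LV: "V.L = L"
  proof
    show "V.L \<subseteq> L"
    proof
      fix w assume "w \<in> V.L"
      then obtain m n where "w = of_int m * v1 + of_int n * v2" by (auto simp: lattice_def)
      then have "w = of_int (- m - n) * w1 + of_int (2 * m + n) * w2"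
        by (simp add: v1_def v2_def algebra_simps)
      then show "w \<in> L" unfolding lattice_def by blast
    qed
    show "L \<subseteq> V.L"
    proof
      fix w assume "w \<in> L"
      then obtain m n where "w = of_int m * w1 + of_int n * w2" by (auto simp: lattice_def)
      then have "w = of_int (m + n) * v1 + of_int (- 2 * m - n) * v2"
        by (simp add: v1_def v2_def algebra_simps)
      then show "w \<in> V.L" unfolding lattice_def by blast
    qed
  qed
  have per: "V.X (w + l) = V.X w" if "w \<notin> L" "l \<in> L" for w l
    using V.X_facts(1) that by (simp add: elliptic_def LV)
  have perX: "X (w + l) = X w" if "w \<notin> L" "l \<in> L" for w l
    using X_facts(1) that by (simp add: elliptic_def)
  have v2L: "v2 \<in> L" using lattice_diff[of w2 w1] periods_in_lattice by (simp add: v2_def)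
  have XV: "V.X w = X w" if "w \<notin> L" for w
  proof (rule X_unique)
    show "elliptic L V.X" using V.X_facts(1) by (simp add: LV)
    show "(\<lambda>w. w\<^sup>2 * V.X w) \<midarrow>0\<rightarrow> 4" by (rule V.X_facts(2))
    have "V.X (w1 / 2 + v2) = V.X (w1 / 2)" using per half_periods_notin v2L by blast
    moreover have "w1 / 2 + v2 = v1 / 2" by (simp add: v1_def v2_def field_simps)
    ultimately show "V.X (w1 / 2) = 0" using V.X_facts(3) by simp
    show "deriv V.X (w1 / 2) = 0"
      using V.X_deriv[of "w1 / 2"] half_periods_notin periods_in_lattice by (simp add: LV)
  qed (rule that)
  have B: "V.B = B"
  proof -
    have e: "w2 / 2 + v1 / 2 = (w1 + w2) / 2 + v2" "w2 / 2 + w1 / 2 = (w1 + w2) / 2"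
      by (simp_all add: v1_def v2_def field_simps)
    have n: "(w1 + w2) / 2 + v2 \<notin> L" using half_periods_notin lattice_add_iff[OF v2L] by simp
    have "V.X (w2 / 2) * V.X (w2 / 2 + v1 / 2) = V.B"
      using V.X_mult_shift[of "w2 / 2"] half_periods_notin n e by (simp only: LV not_False_eq_True)
    moreover have "X (w2 / 2) * X (w2 / 2 + w1 / 2) = B"
      using X_mult_shift[of "w2 / 2"] half_periods_notin e by (simp only: not_False_eq_True)
    moreover have "V.X (w2 / 2 + v1 / 2) = X (w2 / 2 + w1 / 2)"
      unfolding e using XV[OF n] perX[OF half_periods_notin(3) v2L] by simp
    ultimately show ?thesis using XV[OF half_periods_notin(2)] by simp
  qed
  \<comment> \<open>The change of basis interchanges the two unmarked half periods modulo L; the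
    square does not notice the sign.\<close>
  have diff: "(V.X ((v1 + v2) / 2) - V.X (v2 / 2))\<^sup>2 = (X ((w1 + w2) / 2) - X (w2 / 2))\<^sup>2"
  proof -
    have e: "(v1 + v2) / 2 = w2 / 2 + v2" "v2 / 2 = (w1 + w2) / 2 + - w1"
      by (simp_all add: v1_def v2_def field_simps)
    have n: "w2 / 2 + v2 \<notin> L" "(w1 + w2) / 2 + - w1 \<notin> L"
      using half_periods_notin lattice_add_iff[OF v2L]
        lattice_add_iff[OF lattice_minus[OF periods_in_lattice(1)], of "(w1 + w2) / 2"] by simp_all
    have "V.X ((v1 + v2) / 2) = X (w2 / 2)" "V.X (v2 / 2) = X ((w1 + w2) / 2)"
      unfolding e XV[OF n(1)] XV[OF n(2)]
      using perX[OF half_periods_notin(2) v2L]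
        perX[OF half_periods_notin(3) lattice_minus[OF periods_in_lattice(1)]] by auto
    then show ?thesis by (simp add: power2_commute)
  qed
  show ?eta8 ?eta24
    using V.eta_quotient_B V.eta_quotient_diff eta_quotient_diff
    unfolding B diff unfolding v1_def v2_def by simp_all
qed

end

lemma eta_quotients_admissible:
  assumes "b \<noteq> 0" and adm: "admissible_basis a b w1 w2"
  shows "dedekind_eta (2 * (w2 / w1)) ^ 24 / dedekind_eta (w2 / w1) ^ 24 = (a\<^sup>2 - 4 * b) / (2 ^ 8 * b)"
    and "dedekind_eta (2 * (w2 / w1)) ^ 8 / dedekind_eta (w2 / w1) ^ 16 = (2 * of_real pi / w1) ^ 4 * (1 / b)"
proof -
  obtain \<phi> where adm: "period_lattice a b = lattice w1 w2" "Im (w2 / w1) > 0" "uniformization a b \<phi>" "\<phi> (w1 / 2) = (0, 0)"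
    using adm unfolding admissible_basis_def lattice_def by blast
  interpret period_basis w1 w2 by unfold_locales (rule adm)
  have "b = B" using b_eq_B[OF adm(3,1,4)] .
  then show
    "dedekind_eta (2 * (w2 / w1)) ^ 24 / dedekind_eta (w2 / w1) ^ 24 = (a\<^sup>2 - 4 * b) / (2 ^ 8 * b)"
    "dedekind_eta (2 * (w2 / w1)) ^ 8 / dedekind_eta (w2 / w1) ^ 16 = (2 * of_real pi / w1) ^ 4 * (1 / b)"
    using eta_quotient_B eta_quotient_diff discriminant_eq[OF adm(3,1,4)] by simp_all
qed

section \<open>Logarithms of the eta quotients\<close>

text \<open>One logarithm of (x; x) on the whole disc, chosen as a function of the nome, hence
  unchanged under \<tau> + 1. Which branch is chosen is immaterial, since only changes are
  measured.\<close>

definition log_qpoch :: "complex \<Rightarrow> complex" where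
  "log_qpoch = (SOME l. l holomorphic_on ball 0 1 \<and> (\<forall>x\<in>ball 0 1. qpoch x x = exp (l x)))"

lemma log_qpoch: "log_qpoch holomorphic_on ball 0 1" "norm x < 1 \<Longrightarrow> exp (log_qpoch x) = qpoch x x"
proof -
  obtain l where l: "l holomorphic_on ball 0 1" "\<And>x. x \<in> ball 0 1 \<Longrightarrow> qpoch x x = exp (l x)"
  proof (rule contractible_imp_holomorphic_log[OF qpoch_diagonal_holomorphic])
    show "contractible (ball (0::complex) 1)" by (simp add: convex_imp_contractible)
    show "qpoch z z \<noteq> 0" if "z \<in> ball 0 1" for z
      using that by (intro qpoch_minus_nz(2)) auto
  qed (use that in auto)
  then have "\<exists>l. l holomorphic_on ball 0 1 \<and> (\<forall>x\<in>ball 0 1. qpoch x x = exp (l x))" by blast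
  from someI_ex[OF this] show "log_qpoch holomorphic_on ball 0 1" "norm x < 1 \<Longrightarrow> exp (log_qpoch x) = qpoch x x"
    unfolding log_qpoch_def by auto
qed

definition qexp :: "complex \<Rightarrow> complex" where "qexp \<tau> = exp (2 * of_real pi * \<i> * \<tau>)"

text \<open>A logarithm of eta(2 \<tau>)^24 / eta(\<tau>)^24; the linear term is the logarithm of
  the nome and is what detects the matrix T.\<close>

definition log24 :: "complex \<Rightarrow> complex" where
  "log24 \<tau> = 2 * of_real pi * \<i> * \<tau> + 24 * (log_qpoch ((qexp \<tau>)\<^sup>2) - log_qpoch (qexp \<tau>))"

text \<open>One quarter of a logarithm of eta(2 \<tau>)^8 / eta(\<tau>)^16, where the powers of the
  nome cancel: 2 * 8 = 16. Its exponential is the fourth root that detects the charge in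
  Z_4.\<close>

definition log8 :: "complex \<Rightarrow> complex" where
  "log8 \<tau> = 2 * log_qpoch ((qexp \<tau>)\<^sup>2) - 4 * log_qpoch (qexp \<tau>)"

lemma norm_qexp: "Im \<tau> > 0 \<Longrightarrow> norm (qexp \<tau>) < 1"
  by (simp add: qexp_def)

lemma exp_log_quotients:
  assumes "Im \<tau> > 0"
  shows "exp (log24 \<tau>) = dedekind_eta (2 * \<tau>) ^ 24 / dedekind_eta \<tau> ^ 24"
    and "exp (4 * log8 \<tau>) = dedekind_eta (2 * \<tau>) ^ 8 / dedekind_eta \<tau> ^ 16"
proof -
  interpret period_basis 1 \<tau> by unfold_locales (use assms in simp)
  have q: "q = qexp \<tau>" by (simp add: q_def qexp_def)
  have n: "norm (qexp \<tau>) < 1" "norm ((qexp \<tau>)\<^sup>2) < 1"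
    using norm_q norm_square_less_1[OF norm_q] by (simp_all add: q)
  have E: "exp (log_qpoch (qexp \<tau>)) = qpoch q q" "exp (log_qpoch ((qexp \<tau>)\<^sup>2)) = qpoch q q * qpoch q (- q)"
    using log_qpoch(2)[OF n(1)] log_qpoch(2)[OF n(2)] qpoch_q_euler[OF norm_q] by (simp_all add: q)
  have nz: "qpoch q q \<noteq> 0" by (rule qpoch_minus_nz(2)[OF norm_q])
  have "exp (log24 \<tau>) = qexp \<tau> * (exp (log_qpoch ((qexp \<tau>)\<^sup>2)) / exp (log_qpoch (qexp \<tau>))) ^ 24"
    unfolding log24_def exp_add exp_diff[symmetric] exp_of_nat_mult[symmetric] by (simp add: qexp_def)
  also have "\<dots> = q * qpoch q (- q) ^ 24"
    unfolding E using nz by (simp add: q)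
  finally show "exp (log24 \<tau>) = dedekind_eta (2 * \<tau>) ^ 24 / dedekind_eta \<tau> ^ 24"
    using eta_quotient_24 by simp
  have "4 * log8 \<tau> = of_nat 8 * log_qpoch ((qexp \<tau>)\<^sup>2) - of_nat 16 * log_qpoch (qexp \<tau>)"
    by (simp add: log8_def)
  then have "exp (4 * log8 \<tau>) = exp (log_qpoch ((qexp \<tau>)\<^sup>2)) ^ 8 / exp (log_qpoch (qexp \<tau>)) ^ 16"
    by (simp only: exp_diff exp_of_nat_mult)
  also have "\<dots> = qpoch q q ^ 8 * qpoch q (- q) ^ 8 / (qpoch q q ^ 8 * qpoch q q ^ 8)"
  proof -
    have "qpoch q q ^ 16 = qpoch q q ^ 8 * qpoch q q ^ 8" by (simp flip: power_add)
    then show ?thesis unfolding E power_mult_distrib by (simp only:)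
  qed
  also have "\<dots> = qpoch q (- q) ^ 8 / qpoch q q ^ 8"
  proof -
    have "u * m / (u * u) = m / u" if "u \<noteq> 0" for u m :: complex using that by simp
    then show ?thesis using nz by (metis power_not_zero)
  qed
  finally show "exp (4 * log8 \<tau>) = dedekind_eta (2 * \<tau>) ^ 8 / dedekind_eta \<tau> ^ 16"
    using eta_quotient_8 by simp
qed

lemma continuous_on_logs:
  "continuous_on {\<tau>. Im \<tau> > 0} log24" "continuous_on {\<tau>. Im \<tau> > 0} log8"
proof -
  have c: "continuous_on (ball 0 1) log_qpoch"
    using log_qpoch(1) by (rule holomorphic_on_imp_continuous_on)
  have 1: "continuous_on {\<tau>. Im \<tau> > 0} (\<lambda>\<tau>. log_qpoch (qexp \<tau>))"
    by (rule continuous_on_compose2[OF c]) (auto intro!: continuous_intros simp: qexp_def)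
  have 2: "continuous_on {\<tau>. Im \<tau> > 0} (\<lambda>\<tau>. log_qpoch ((qexp \<tau>)\<^sup>2))"
  proof (rule continuous_on_compose2[OF c])
    show "continuous_on {\<tau>. Im \<tau> > 0} (\<lambda>\<tau>. (qexp \<tau>)\<^sup>2)"
      unfolding qexp_def by (intro continuous_intros)
    show "(\<lambda>\<tau>. (qexp \<tau>)\<^sup>2) ` {\<tau>. Im \<tau> > 0} \<subseteq> ball 0 1"
      using norm_square_less_1 norm_qexp by auto
  qed
  show "continuous_on {\<tau>. Im \<tau> > 0} log24" "continuous_on {\<tau>. Im \<tau> > 0} log8"
    unfolding log24_def log8_def by (intro continuous_intros 1 2)+
qed

lemma logs_translate: "log24 (\<tau> + 1) = log24 \<tau> + 2 * of_real pi * \<i>" "log8 (\<tau> + 1) = log8 \<tau>"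
proof -
  have "qexp (\<tau> + 1) = qexp \<tau>" by (simp add: qexp_def ring_distribs exp_add)
  then show "log24 (\<tau> + 1) = log24 \<tau> + 2 * of_real pi * \<i>" "log8 (\<tau> + 1) = log8 \<tau>"
    by (simp_all add: log24_def log8_def ring_distribs)
qed

lemma eta_quotients_X:
  assumes "Im \<tau> > 0"
  shows "exp (log24 ((\<tau> - 1) / (2 * \<tau> - 1))) = exp (log24 \<tau>)"
    and "(2 * \<tau> - 1) ^ 4 * exp (4 * log8 ((\<tau> - 1) / (2 * \<tau> - 1))) = exp (4 * log8 \<tau>)"
    and "Im ((\<tau> - 1) / (2 * \<tau> - 1)) > 0" "2 * \<tau> - 1 \<noteq> 0"
proof -
  interpret period_basis 1 \<tau> by unfold_locales (use assms in simp)
  show pos: "Im ((\<tau> - 1) / (2 * \<tau> - 1)) > 0"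
    using Im_moebius_pos[OF assms, of 1 "-1" "-1" 2] by simp
  show nz: "2 * \<tau> - 1 \<noteq> 0"
    using moebius_denominator_nz[OF assms, of 1 "-1" "-1" 2] by simp
  show "exp (log24 ((\<tau> - 1) / (2 * \<tau> - 1))) = exp (log24 \<tau>)"
    unfolding exp_log_quotients(1)[OF assms] exp_log_quotients(1)[OF pos]
    using X_transform(2) by simp
  have "exp (4 * log8 ((\<tau> - 1) / (2 * \<tau> - 1))) = (2 * of_real pi / (2 * \<tau> - 1)) ^ 4 * (1 / B)"
    unfolding exp_log_quotients(2)[OF pos] using X_transform(1) by simp
  moreover have "exp (4 * log8 \<tau>) = (2 * of_real pi) ^ 4 * (1 / B)"
    unfolding exp_log_quotients(2)[OF assms] using eta_quotient_B by simp
  ultimately show "(2 * \<tau> - 1) ^ 4 * exp (4 * log8 ((\<tau> - 1) / (2 * \<tau> - 1))) = exp (4 * log8 \<tau>)"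
    using nz by (simp add: power_divide)
qed

text \<open>Two distinct values with the same exponential are at least 2 pi apart, so f has discrete
  range.\<close>

lemma continuous_exp_const:
  fixes f :: "'a::topological_space \<Rightarrow> complex"
  assumes "connected S" "continuous_on S f" and e: "\<And>x. x \<in> S \<Longrightarrow> exp (f x) = c" and xy: "x \<in> S" "y \<in> S"
  shows "f x = f y"
proof -
  have "f constant_on S"
  proof (rule continuous_discrete_range_constant[OF assms(1,2)])
    fix x assume x: "x \<in> S"
    have "2 * pi \<le> norm (f y - f x)" if y: "y \<in> S" "f y \<noteq> f x" for y
    proof (rule ccontr)
      assume n: "\<not> 2 * pi \<le> norm (f y - f x)"
      have "f y = f x"
      proof (rule exp_complex_eqI)
        show "\<bar>Im (f y) - Im (f x)\<bar> < 2 * pi"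
          using n abs_Im_le_cmod[of "f y - f x"] by simp
        show "exp (f y) = exp (f x)" using e x y by simp
      qed
      with y show False by simp
    qed
    then show "\<exists>e>0. \<forall>y. y \<in> S \<and> f y \<noteq> f x \<longrightarrow> e \<le> norm (f y - f x)"
      by (intro exI[of _ "2 * pi"]) auto
  qed
  then show ?thesis using xy by (auto simp: constant_on_def)
qed

lemma continuous_fourth_power_const:
  fixes f :: "'a::topological_space \<Rightarrow> complex"
  assumes "connected S" "continuous_on S f" and e: "\<And>x. x \<in> S \<Longrightarrow> f x ^ 4 = c" and xy: "x \<in> S" "y \<in> S"
  shows "f x = f y"
proof -
  have "f constant_on S"
  proof (rule continuous_finite_range_constant[OF assms(1,2)])
    have "finite {z. poly ([:0, 1:] ^ 4 - [:c:]) z = 0}"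
    proof (rule poly_roots_finite)
      have "coeff ([:0, 1:] ^ 4 - [:c:]) 4 = 1"
        by (simp add: power4_eq_xxxx numeral_eq_Suc coeff_pCons)
      then show "[:0, 1:] ^ 4 - [:c:] \<noteq> 0" by (metis coeff_0 zero_neq_one)
    qed
    then have "finite {z. z ^ 4 = c}" by (simp add: poly_power)
    then show "finite (f ` S)" by (rule finite_subset[rotated]) (use e in auto)
  qed
  then show ?thesis using xy by (auto simp: constant_on_def)
qed

lemma connected_upper_half_plane: "connected {\<tau>. Im \<tau> > 0}"
  by (simp add: convex_connected convex_halfspace_Im_gt)

lemma fixed_point_X:
  defines "\<tau>0 \<equiv> (1 + \<i>) / 2"
  shows "Im \<tau>0 > 0" "2 * \<tau>0 - 1 = \<i>" "(\<tau>0 - 1) / (2 * \<tau>0 - 1) = \<tau>0"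
proof -
  show "Im \<tau>0 > 0" by (simp add: \<tau>0_def)
  show 1: "2 * \<tau>0 - 1 = \<i>" by (simp add: \<tau>0_def complex_eq_iff)
  show "(\<tau>0 - 1) / (2 * \<tau>0 - 1) = \<tau>0"
    unfolding 1 by (simp add: \<tau>0_def complex_eq_iff)
qed

lemma continuous_on_moebius_X: "continuous_on {\<tau>. Im \<tau> > 0} (\<lambda>\<tau>. (\<tau> - 1) / (2 * \<tau> - 1))"
  using eta_quotients_X(4) by (intro continuous_intros) auto

lemma continuous_on_compose_X:
  assumes "continuous_on {\<tau>. Im \<tau> > 0} f"
  shows "continuous_on {\<tau>. Im \<tau> > 0} (\<lambda>\<tau>. f ((\<tau> - 1) / (2 * \<tau> - 1)))"
  by (rule continuous_on_compose2[OF assms continuous_on_moebius_X]) (use eta_quotients_X(3) in auto)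

text \<open>
  Both discrepancies are continuous with discrete values, hence constant on the upper half plane,
  and are read off at the fixed point (1 + i)/2 of the transformation.
\<close>

lemma log24_X:
  assumes "Im \<tau> > 0"
  shows "log24 ((\<tau> - 1) / (2 * \<tau> - 1)) = log24 \<tau>"
proof -
  let ?f = "\<lambda>\<tau>. log24 ((\<tau> - 1) / (2 * \<tau> - 1)) - log24 \<tau>"
  have e: "exp (?f \<tau>) = 1" if "Im \<tau> > 0" for \<tau>
    using eta_quotients_X(1)[OF that] by (simp add: exp_diff)
  have "?f \<tau> = ?f ((1 + \<i>) / 2)"
    by (rule continuous_exp_const[OF connected_upper_half_plane _ e])
       (use assms fixed_point_X(1) in \<open>auto intro!: continuous_intros continuous_on_compose_X continuous_on_logs\<close>)
  then show ?thesis unfolding fixed_point_X(3) by simp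
qed

lemma log8_X:
  assumes "Im \<tau> > 0"
  shows "(2 * \<tau> - 1) * exp (log8 ((\<tau> - 1) / (2 * \<tau> - 1))) = \<i> * exp (log8 \<tau>)"
proof -
  let ?f = "\<lambda>\<tau>. (2 * \<tau> - 1) * exp (log8 ((\<tau> - 1) / (2 * \<tau> - 1))) / exp (log8 \<tau>)"
  have e: "(?f \<tau>) ^ 4 = 1" if "Im \<tau> > 0" for \<tau>
    using eta_quotients_X(2)[OF that] by (simp add: power_divide power_mult_distrib flip: exp_of_nat_mult)
  have "?f \<tau> = ?f ((1 + \<i>) / 2)"
    by (rule continuous_fourth_power_const[OF connected_upper_half_plane _ e])
       (use assms fixed_point_X(1) in \<open>auto intro!: continuous_intros continuous_on_compose_X continuous_on_logs\<close>)
  \<comment> \<open>At the fixed point the two exponentials cancel and only the factor 2 \<tau> - 1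
    = i is left.\<close>
  then have "?f \<tau> = \<i>" unfolding fixed_point_X(3) unfolding fixed_point_X(2) by simp
  then show ?thesis by (simp add: divide_eq_eq)
qed

section \<open>The action of $\Gamma_0(2)$ on the logarithms\<close>

definition mat2 :: "int \<Rightarrow> int \<Rightarrow> int \<Rightarrow> int \<Rightarrow> int ^ 2 ^ 2" where
  "mat2 p q r s = vector [vector [p, q], vector [r, s]]"

lemma mat2_nth [simp]:
  "vec_nth (vec_nth (mat2 p q r s) 1) 1 = p" "vec_nth (vec_nth (mat2 p q r s) 1) 2 = q"
  "vec_nth (vec_nth (mat2 p q r s) 2) 1 = r" "vec_nth (vec_nth (mat2 p q r s) 2) 2 = s"
  by (simp_all add: mat2_def)

lemma mat2_mult: "mat2 p q r s ** mat2 p' q' r' s' =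
    mat2 (p * p' + q * r') (p * q' + q * s') (r * p' + s * r') (r * q' + s * s')"
  by (simp add: vec_eq_iff forall_2 matrix_matrix_mult_def sum_2)

lemma mat_T_mat2: "mat_T = mat2 1 1 0 1" and mat_X_mat2: "mat_X = mat2 1 (-1) 2 (-1)"
  and mat_1_mat2: "mat 1 = mat2 1 0 0 1"
  by (simp_all add: vec_eq_iff forall_2 mat_T_def mat_X_def mat_def)

lemma mat2_carrier: "mat2 p q r s \<in> carrier Gamma0_2 \<longleftrightarrow> p * s - q * r = 1 \<and> even r"
  by (simp add: Gamma0_2_def det_2)

text \<open>
  Euclidean descent on the first column: T^{-1} subtracts the lower entry from the upper one, and
  T^{-1} X replaces (p, r) by (-p, 2p - r).
\<close>

lemma Gamma0_2_induct:
  fixes P :: "int \<Rightarrow> int \<Rightarrow> int \<Rightarrow> int \<Rightarrow> bool"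
  assumes one: "P 1 0 0 1"
    and T: "\<And>p q r s. p * s - q * r = 1 \<Longrightarrow> even r \<Longrightarrow> P p q r s \<longleftrightarrow> P (p + r) (q + s) r s"
    and X: "\<And>p q r s. p * s - q * r = 1 \<Longrightarrow> even r \<Longrightarrow>
              P p q r s \<longleftrightarrow> P (p - r) (q - s) (2 * p - r) (2 * q - s)"
    and M: "p * s - q * r = 1" "even r"
  shows "P p q r s"
  using M
proof (induction "nat (\<bar>p\<bar> + \<bar>r\<bar>)" arbitrary: p q r s rule: less_induct)
  case less
  note det = less.prems(1) and even = less.prems(2)
  have T': "P p q r s \<longleftrightarrow> P (p - r) (q - s) r s"
    using T[of "p - r" s "q - s" r] det even by (simp add: algebra_simps)
  have V: "P p q r s \<longleftrightarrow> P (- p) (- q) (2 * p - r) (2 * q - s)" if "p * s - q * r = 1" "even r" for p q r s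
  proof -
    have "P (- p) (- q) (2 * p - r) (2 * q - s) \<longleftrightarrow>
        P (- p + (2 * p - r)) (- q + (2 * q - s)) (2 * p - r) (2 * q - s)"
      using that by (intro T) (auto simp: algebra_simps)
    also have "\<dots> \<longleftrightarrow> P p q r s"
      using X[OF that] by (simp add: algebra_simps)
    finally show ?thesis by simp
  qed
  \<comment> \<open>The inverse of the move V: applied to the quadruple on the right, V returns the
    one on the left.\<close>
  have V': "P p q r s \<longleftrightarrow> P (- p) (- q) (- 2 * p - r) (- 2 * q - s)"
    using V[of "- p" "- 2 * q - s" "- q" "- 2 * p - r"] det even by (simp add: algebra_simps)
  have "odd p"
  proof
    assume "even p"
    then have "even (p * s - q * r)" using even by simp
    then show False using det by simp
  qed
  show ?case
  proof (cases "r = 0")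
    case True
    with det have "p * s = 1" by simp
    then have ps: "p = 1 \<and> s = 1 \<or> p = -1 \<and> s = -1" by (auto simp: zmult_eq_1_iff)
    have shift: "P p (n * s) 0 s \<longleftrightarrow> P p 0 0 s" for n
    proof (induction n rule: int_induct[where k = 0])
      case (step1 i)
      then show ?case using T[of p s "i * s" 0] ps by (auto simp: algebra_simps)
    next
      case (step2 i)
      then show ?case using T[of p s "(i - 1) * s" 0] ps by (auto simp: algebra_simps)
    qed simp
    \<comment> \<open>X squared is minus the identity.\<close>
    have "P (-1) 0 0 (-1)"
      using X[of 1 1 0 0] X[of 1 "-1" "-1" 2] one by simp
    then have "P p 0 0 s" using one ps by auto
    then show ?thesis using shift[of q] shift[of "- q"] ps True by auto
  next
    case False
    have "p \<noteq> 0" using \<open>odd p\<close> by auto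
    have "\<bar>p\<bar> \<noteq> \<bar>r\<bar>" using \<open>odd p\<close> even by (metis dvd_abs_iff)
    have pos: "0 < \<bar>p\<bar>" "0 < \<bar>r\<bar>" using False \<open>p \<noteq> 0\<close> by auto
    \<comment> \<open>If |r| < |p|, adding or subtracting r shrinks p; if |p| < |r|, adding or
      subtracting 2 p shrinks r. Equality is excluded by parity, and each move keeps the other
      absolute value.\<close>
    consider "\<bar>p - r\<bar> < \<bar>p\<bar>" | "\<bar>p + r\<bar> < \<bar>p\<bar>" | "\<bar>2 * p - r\<bar> < \<bar>r\<bar>" | "\<bar>- 2 * p - r\<bar> < \<bar>r\<bar>"
      using pos \<open>\<bar>p\<bar> \<noteq> \<bar>r\<bar>\<close> by linarith
    then show ?thesis
    proof cases
      case 1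
      have "P (p - r) (q - s) r s"
        using 1 pos det even by (intro less.hyps) (auto simp: algebra_simps)
      then show ?thesis using T' by simp
    next
      case 2
      have "P (p + r) (q + s) r s"
        using 2 pos det even by (intro less.hyps) (auto simp: algebra_simps)
      then show ?thesis using T[OF det even] by simp
    next
      case 3
      have "P (- p) (- q) (2 * p - r) (2 * q - s)"
        using 3 pos det even by (intro less.hyps) (auto simp: algebra_simps)
      then show ?thesis using V[OF det even] by simp
    next
      case 4
      have "P (- p) (- q) (- 2 * p - r) (- 2 * q - s)"
        using 4 pos det even by (intro less.hyps) (auto simp: algebra_simps)
      then show ?thesis using V' by simp
    qed
  qed
qed

section \<open>Charges as transformation defects of the logarithms\<close>

locale charges =
  fixes QZ QZ4 :: "int ^ 2 ^ 2 \<Rightarrow> int"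
  assumes QZ_hom: "QZ \<in> hom Gamma0_2 integer_group"
    and QZ_T: "QZ mat_T = 1"
    and QZ_X: "QZ mat_X = 0"
    and QZ4_hom: "QZ4 \<in> hom Gamma0_2 (integer_mod_group 4)"
    and QZ4_T: "QZ4 mat_T = 0"
    and QZ4_X: "QZ4 mat_X = 1"
begin

lemma QZ_mult: "A \<in> carrier Gamma0_2 \<Longrightarrow> C \<in> carrier Gamma0_2 \<Longrightarrow> QZ (A ** C) = QZ A + QZ C"
  using hom_mult[OF QZ_hom, of A C] by (simp add: Gamma0_2_def integer_group_def)

lemma QZ4_mult:
  "A \<in> carrier Gamma0_2 \<Longrightarrow> C \<in> carrier Gamma0_2 \<Longrightarrow> QZ4 (A ** C) = (QZ4 A + QZ4 C) mod 4"
  using hom_mult[OF QZ4_hom, of A C] by (simp add: Gamma0_2_def)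

lemma QZ4_range: "A \<in> carrier Gamma0_2 \<Longrightarrow> 0 \<le> QZ4 A \<and> QZ4 A < 4"
  using hom_in_carrier[OF QZ4_hom, of A] by (simp add: carrier_integer_mod_group)

text \<open>The power i^n as an exponential, the form in which a quarter of a winding of b appears.
  It turns the charge into a fourth root of unity without losing information.\<close>

definition i_pow :: "int \<Rightarrow> complex" where
  "i_pow n = exp (of_int n * (2 * of_real pi * \<i> / 4))"

lemma i_pow_0: "i_pow 0 = 1" and i_pow_add: "i_pow (m + n) = i_pow m * i_pow n"
  by (simp_all add: i_pow_def ring_distribs exp_add add_divide_distrib)

lemma i_pow_eq_1_iff: "i_pow n = 1 \<longleftrightarrow> 4 dvd n"
proof
  assume "i_pow n = 1"
  then obtain k :: int where "of_int n * (2 * pi) / 4 = of_int (2 * k) * pi"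
    by (auto simp: i_pow_def exp_eq_1)
  then have "(of_int n :: real) = of_int (4 * k)" by simp
  then show "4 dvd n" by (metis dvd_triv_left of_int_eq_iff)
next
  assume "4 dvd n"
  then obtain k where "n = 4 * k" by blast
  then have "i_pow n = exp (2 * of_int k * of_real pi * \<i>)" by (simp add: i_pow_def mult_ac)
  then show "i_pow n = 1" using exp_integer_2pi[OF Ints_of_int] by simp
qed

lemma i_pow_mod: "i_pow (n mod 4) = i_pow n"
proof -
  have "i_pow n = i_pow (n mod 4) * i_pow (4 * (n div 4))"
    unfolding i_pow_add[symmetric] by simp
  also have "i_pow (4 * (n div 4)) = 1" unfolding i_pow_eq_1_iff by simp
  finally show ?thesis by simp
qed

lemma i_pow_1: "i_pow 1 = \<i>"
proof -
  have "of_int 1 * (2 * of_real pi * \<i> / 4) = \<i> * of_real (pi / 2)" by simp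
  then show ?thesis
    by (simp only: i_pow_def cis_conv_exp[symmetric] cis_pi_half)
qed

text \<open>Left multiplication by T or X acts on \<sigma> = \<tau>' by \<sigma> + 1 or (\<sigma> -
  1)/(2 \<sigma> - 1), and under X the automorphy factor gains 2 \<sigma> - 1. So each generator
  changes both laws by its own defect, which is its charge, and the claim spreads over the group in
  both directions.\<close>

theorem log_transformation:
  assumes M: "p * s - q * r = 1" "even r" and \<tau>: "Im \<tau> > 0"
  defines "\<tau>' \<equiv> (of_int p * \<tau> + of_int q) / (of_int r * \<tau> + of_int s)"
  shows "log24 \<tau>' = log24 \<tau> + 2 * of_real pi * \<i> * of_int (QZ (mat2 p q r s))"
    and "(of_int r * \<tau> + of_int s) * exp (log8 \<tau>') = i_pow (QZ4 (mat2 p q r s)) * exp (log8 \<tau>)"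
proof -
  define m where "m p q r s \<tau> = (of_int p * \<tau> + of_int q) / (of_int r * \<tau> + of_int s)" for p q r s and \<tau> :: complex
  define P where "P p q r s \<longleftrightarrow> (\<forall>\<tau>. Im \<tau> > 0 \<longrightarrow>
      log24 (m p q r s \<tau>) = log24 \<tau> + 2 * of_real pi * \<i> * of_int (QZ (mat2 p q r s)) \<and>
      (of_int r * \<tau> + of_int s) * exp (log8 (m p q r s \<tau>)) = i_pow (QZ4 (mat2 p q r s)) * exp (log8 \<tau>))"
    for p q r s
  have den: "of_int r * \<tau> + of_int s \<noteq> 0" and pos: "Im (m p q r s \<tau>) > 0"
    if "p * s - q * r = 1" "Im \<tau> > 0" for p q r s \<tau>
  proof -
    have d: "real_of_int p * real_of_int s - real_of_int q * real_of_int r = 1"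
      using that(1) by (metis of_int_1 of_int_diff of_int_mult)
    show "of_int r * \<tau> + of_int s \<noteq> 0" using moebius_denominator_nz[OF that(2) d] by simp
    show "Im (m p q r s \<tau>) > 0" using Im_moebius_pos[OF that(2) d] by (simp add: m_def)
  qed
  have gen: "mat_T \<in> carrier Gamma0_2" "mat_X \<in> carrier Gamma0_2" "mat 1 \<in> carrier Gamma0_2"
    by (simp_all add: mat_T_mat2 mat_X_mat2 mat_1_mat2 mat2_carrier)
  have "P p q r s"
    using _ _ _ M
  proof (rule Gamma0_2_induct)
    have "QZ (mat 1) = 0" using QZ_mult[OF gen(3,3)] by simp
    \<comment> \<open>The identity is idempotent, so x = 2 x modulo 4; among the representatives 0
      to 3 only 0 satisfies this.\<close>
    moreover have "QZ4 (mat 1) = 0" using QZ4_mult[OF gen(3,3)] QZ4_range[OF gen(3)] by simp presburger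
    ultimately show "P 1 0 0 1" by (simp add: P_def m_def mat_1_mat2 i_pow_0)
  next
    fix p q r s :: int assume M: "p * s - q * r = 1" "even r"
    have TM: "mat_T ** mat2 p q r s = mat2 (p + r) (q + s) r s" by (simp add: mat_T_mat2 mat2_mult)
    have c: "mat2 p q r s \<in> carrier Gamma0_2" using M by (simp add: mat2_carrier)
    have Q: "QZ (mat2 (p + r) (q + s) r s) = QZ (mat2 p q r s) + 1"
      and Q4: "QZ4 (mat2 (p + r) (q + s) r s) = QZ4 (mat2 p q r s)"
      using QZ_mult[OF gen(1) c] QZ4_mult[OF gen(1) c] QZ4_range[OF c] by (simp_all add: TM QZ_T QZ4_T)
    have "m (p + r) (q + s) r s \<tau> = m p q r s \<tau> + 1" if "Im \<tau> > 0" for \<tau>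
      using den[OF M(1) that] by (simp add: m_def add_divide_eq_iff divide_add_eq_iff algebra_simps)
    then show "P p q r s \<longleftrightarrow> P (p + r) (q + s) r s"
      unfolding P_def Q Q4 by (simp add: logs_translate ring_distribs)
  next
    fix p q r s :: int assume M: "p * s - q * r = 1" "even r"
    let ?N = "mat2 (p - r) (q - s) (2 * p - r) (2 * q - s)"
    have XM: "mat_X ** mat2 p q r s = ?N" by (simp add: mat_X_mat2 mat2_mult)
    have c: "mat2 p q r s \<in> carrier Gamma0_2" using M by (simp add: mat2_carrier)
    have Q: "QZ ?N = QZ (mat2 p q r s)" and Q4: "i_pow (QZ4 ?N) = \<i> * i_pow (QZ4 (mat2 p q r s))"
      using QZ_mult[OF gen(2) c] QZ4_mult[OF gen(2) c]
      by (simp_all add: XM QZ_X QZ4_X i_pow_mod i_pow_add i_pow_1)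
    have "log24 (m (p - r) (q - s) (2 * p - r) (2 * q - s) \<tau>) = log24 (m p q r s \<tau>) \<and>
        (of_int (2 * p - r) * \<tau> + of_int (2 * q - s)) * exp (log8 (m (p - r) (q - s) (2 * p - r) (2 * q - s) \<tau>)) =
        \<i> * ((of_int r * \<tau> + of_int s) * exp (log8 (m p q r s \<tau>)))" if \<tau>: "Im \<tau> > 0" for \<tau>
    proof -
      define \<sigma> d where "\<sigma> = m p q r s \<tau>" and "d = of_int r * \<tau> + of_int s"
      have d: "d \<noteq> 0" and \<sigma>: "Im \<sigma> > 0" unfolding d_def \<sigma>_def using den pos M(1) \<tau> by blast+
      have n: "of_int p * \<tau> + of_int q = \<sigma> * d" using d by (simp add: \<sigma>_def m_def d_def)
      have e1: "of_int (p - r) * \<tau> + of_int (q - s) = (\<sigma> - 1) * d"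
        using n by (simp add: d_def algebra_simps)
      have e2: "of_int (2 * p - r) * \<tau> + of_int (2 * q - s) = (2 * \<sigma> - 1) * d"
      proof -
        have "of_int (2 * p - r) * \<tau> + of_int (2 * q - s) = 2 * (of_int p * \<tau> + of_int q) - d"
          by (simp add: d_def algebra_simps)
        then show ?thesis unfolding n by (simp add: algebra_simps)
      qed
      have "m (p - r) (q - s) (2 * p - r) (2 * q - s) \<tau> = (\<sigma> - 1) / (2 * \<sigma> - 1)"
        unfolding m_def e1 e2 using d by simp
      then show ?thesis
        unfolding e2 using log24_X[OF \<sigma>] log8_X[OF \<sigma>]
        by (simp add: \<sigma>_def[symmetric] d_def[symmetric] mult.left_commute mult.assoc)
    qed
    then show "P p q r s \<longleftrightarrow> P (p - r) (q - s) (2 * p - r) (2 * q - s)"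
      unfolding P_def Q Q4 by (auto simp: mult.assoc)
  qed
  then show "log24 \<tau>' = log24 \<tau> + 2 * of_real pi * \<i> * of_int (QZ (mat2 p q r s))"
    and "(of_int r * \<tau> + of_int s) * exp (log8 \<tau>') = i_pow (QZ4 (mat2 p q r s)) * exp (log8 \<tau>)"
    using \<tau> by (simp_all add: P_def m_def \<tau>'_def)
qed

end

section \<open>Bases of the same lattice\<close>

context period_basis
begin

lemma int_coefficients_unique:
  assumes "of_int m * w1 + of_int n * w2 = of_int m' * w1 + of_int n' * w2"
  shows "m = m'" "n = n'"
proof -
  have "cs (of_int m * w1 + of_int n * w2) = of_int m" "ct (of_int m * w1 + of_int n * w2) = of_int n" for m n
    using cs_comb[of "of_int m" "of_int n"] ct_comb[of "of_int m" "of_int n"] by simp_all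
  then show "m = m'" "n = n'" using assms by (metis of_int_eq_iff)+
qed

text \<open>Expressing each basis in the other gives inverse integer matrices, so the determinant is
  1 or -1; the common orientation makes it positive.\<close>

lemma change_of_basis:
  assumes v: "period_basis v1 v2" and eq: "lattice v1 v2 = L"
  obtains p q r s :: int where "v2 = of_int p * w2 + of_int q * w1" "v1 = of_int r * w2 + of_int s * w1"
    "p * s - q * r = 1"
proof -
  interpret V: period_basis v1 v2 by (rule v)
  have "v1 \<in> L" "v2 \<in> L" "w1 \<in> V.L" "w2 \<in> V.L"
    using V.periods_in_lattice periods_in_lattice by (auto simp: eq)
  then obtain p q r s p' q' r' s' where
    v2: "v2 = of_int q * w1 + of_int p * w2" and v1: "v1 = of_int s * w1 + of_int r * w2" and
    w2: "w2 = of_int q' * v1 + of_int p' * v2" and w1: "w1 = of_int s' * v1 + of_int r' * v2"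
    unfolding lattice_def by blast
  have "of_int 1 * w1 + of_int 0 * w2 = of_int (s' * s + r' * q) * w1 + of_int (s' * r + r' * p) * w2"
    using w1[unfolded v1 v2] by (simp add: algebra_simps)
  from int_coefficients_unique[OF this] have 1: "s' * s + r' * q = 1" "s' * r + r' * p = 0" by simp_all
  have "of_int 0 * w1 + of_int 1 * w2 = of_int (q' * s + p' * q) * w1 + of_int (q' * r + p' * p) * w2"
    using w2[unfolded v1 v2] by (simp add: algebra_simps)
  from int_coefficients_unique[OF this] have 2: "q' * s + p' * q = 0" "q' * r + p' * p = 1" by simp_all
  have "(p' * s' - q' * r') * (p * s - q * r) =
      (q' * r + p' * p) * (s' * s + r' * q) - (q' * s + p' * q) * (s' * r + r' * p)"
    by (simp add: algebra_simps)
  then have det: "(p' * s' - q' * r') * (p * s - q * r) = 1" by (simp add: 1 2)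
  have "p * s - q * r > 0"
  proof -
    define t where "t = w2 / w1"
    have w2t: "w2 = t * w1" using w1_nz by (simp add: t_def)
    define n d where "n = of_int p * t + of_int q" and "d = of_int r * t + of_int s"
    have "v2 = n * w1" "v1 = d * w1"
      unfolding v1 v2 by (simp_all add: n_def d_def w2t algebra_simps)
    then have vt: "v2 / v1 = n / d" and d0: "d \<noteq> 0" using w1_nz V.w1_nz by auto
    have "(Re d)\<^sup>2 + (Im d)\<^sup>2 > 0" using d0 by (metis complex_neq_0)
    moreover have "Im n * Re d - Re n * Im d = Im t * of_int (p * s - q * r)"
      by (simp add: n_def d_def algebra_simps)
    ultimately have "Im t * of_int (p * s - q * r) > 0"
      using V.Im_pos unfolding vt Im_divide by (simp add: zero_less_divide_iff)
    then show ?thesis using Im_pos by (simp add: t_def zero_less_mult_iff del: of_int_diff)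
  qed
  then have "p * s - q * r = 1" using det by (auto simp: zmult_eq_1_iff)
  then show ?thesis using that[of p q r s] v1 v2 by (simp add: add.commute)
qed

end

section \<open>Winding numbers and monodromy\<close>

text \<open>P splits into linear factors, and each has a continuous logarithm along the path whose
  increment is 2 pi i times a winding number. The logarithm of the leading coefficient drops out of
  the increment.\<close>

lemma poly_continuous_log:
  fixes P :: "complex poly"
  assumes P: "P \<noteq> 0" and \<gamma>: "path \<gamma>" and nz: "\<And>z. z \<in> path_image \<gamma> \<Longrightarrow> poly P z \<noteq> 0"
  obtains g where "continuous_on {0..1} g" "\<And>t. t \<in> {0..1} \<Longrightarrow> exp (g t) = poly P (\<gamma> t)"
    "g 1 - g 0 = 2 * of_real pi * \<i> * (\<Sum>z | poly P z = 0. of_nat (Polynomial.order z P) * winding_number \<gamma> z)"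
proof -
  have "\<exists>g. path g \<and> pathfinish g - pathstart g = 2 * of_real pi * \<i> * winding_number \<gamma> z \<and>
      (\<forall>t\<in>{0..1}. \<gamma> t = z + exp (g t))" if "poly P z = 0" for z
  proof -
    have "z \<notin> path_image \<gamma>" using nz that by blast
    from winding_number_as_continuous_log[OF \<gamma> this] show ?thesis by metis
  qed
  then obtain G where G: "\<And>z. poly P z = 0 \<Longrightarrow> path (G z)"
    "\<And>z. poly P z = 0 \<Longrightarrow> pathfinish (G z) - pathstart (G z) = 2 * of_real pi * \<i> * winding_number \<gamma> z"
    "\<And>z t. poly P z = 0 \<Longrightarrow> t \<in> {0..1} \<Longrightarrow> \<gamma> t = z + exp (G z t)"
    by metis
  define g where "g t = Ln (lead_coeff P) + (\<Sum>z | poly P z = 0. of_nat (Polynomial.order z P) * G z t)" for t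
  show ?thesis
  proof (rule that[of g])
    show "continuous_on {0..1} g"
      unfolding g_def using G(1) by (intro continuous_intros) (auto simp: path_def)
    show "exp (g t) = poly P (\<gamma> t)" if "t \<in> {0..1}" for t
    proof -
      have "exp (g t) = lead_coeff P * (\<Prod>z | poly P z = 0. exp (G z t) ^ Polynomial.order z P)"
        unfolding g_def exp_add using P poly_roots_finite[OF P] by (simp add: exp_sum exp_of_nat_mult)
      also have "(\<Prod>z | poly P z = 0. exp (G z t) ^ Polynomial.order z P) =
          (\<Prod>z | poly P z = 0. (\<gamma> t - z) ^ Polynomial.order z P)"
        using G(3)[OF _ that] by (intro prod.cong) auto
      also have "lead_coeff P * \<dots> = poly (smult (lead_coeff P) (\<Prod>z | poly P z = 0. [:- z, 1:] ^ Polynomial.order z P)) (\<gamma> t)"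
        by (simp add: poly_prod)
      also have "\<dots> = poly P (\<gamma> t)" by (simp only: complex_poly_decompose)
      finally show ?thesis .
    qed
    have "g 1 - g 0 = (\<Sum>z | poly P z = 0. of_nat (Polynomial.order z P) * (G z 1 - G z 0))"
      by (simp add: g_def sum_subtractf[symmetric] right_diff_distrib)
    also have "\<dots> = (\<Sum>z | poly P z = 0. 2 * of_real pi * \<i> * (of_nat (Polynomial.order z P) * winding_number \<gamma> z))"
      using G(2) by (intro sum.cong) (auto simp: pathfinish_def pathstart_def)
    finally show "g 1 - g 0 = 2 * of_real pi * \<i> * (\<Sum>z | poly P z = 0. of_nat (Polynomial.order z P) * winding_number \<gamma> z)"
      by (simp add: sum_distrib_left)
  qed
qed

text \<open>\<open>R\<close> stands for b D, so that both charges are sums over one index set; zeros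
  of \<open>R\<close> that are not zeros of \<open>P\<close> contribute order 0.\<close>

lemma poly_continuous_log_simple_loop:
  fixes P R :: "complex poly"
  assumes dvd: "P dvd R" and R: "R \<noteq> 0" and \<gamma>: "positive_simple_loop \<gamma>"
    and nz: "\<And>z. z \<in> path_image \<gamma> \<Longrightarrow> poly R z \<noteq> 0"
  obtains g where "continuous_on {0..1} g" "\<And>t. t \<in> {0..1} \<Longrightarrow> exp (g t) = poly P (\<gamma> t)"
    "g 1 - g 0 = 2 * of_real pi * \<i> *
      of_int (\<Sum>z | z \<in> inside (path_image \<gamma>) \<and> poly R z = 0. int (Polynomial.order z P))"
proof -
  have P: "P \<noteq> 0" using dvd R by auto
  have root: "poly P z = 0 \<Longrightarrow> poly R z = 0" for z using dvd by (auto elim!: dvdE)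
  have path: "path \<gamma>" using \<gamma> simple_path_imp_path by (auto simp: positive_simple_loop_def)
  obtain g where g: "continuous_on {0..1} g" "\<And>t. t \<in> {0..1} \<Longrightarrow> exp (g t) = poly P (\<gamma> t)"
    "g 1 - g 0 = 2 * of_real pi * \<i> * (\<Sum>z | poly P z = 0. of_nat (Polynomial.order z P) * winding_number \<gamma> z)"
    using poly_continuous_log[OF P path] nz root by blast
  let ?I = "{z. z \<in> inside (path_image \<gamma>) \<and> poly R z = 0}"
  have wn: "winding_number \<gamma> z = (if z \<in> inside (path_image \<gamma>) then 1 else 0)" if "poly P z = 0" for z
  proof (cases "z \<in> inside (path_image \<gamma>)")
    case True
    then show ?thesis using \<gamma> by (auto simp: positive_simple_loop_def)
  next
    case False
    then have "z \<in> outside (path_image \<gamma>)"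
      using inside_Un_outside[of "path_image \<gamma>"] nz root that by blast
    then show ?thesis
      using winding_number_zero_in_outside[OF path] \<gamma> False by (auto simp: positive_simple_loop_def)
  qed
  have "(\<Sum>z | poly P z = 0. of_nat (Polynomial.order z P) * winding_number \<gamma> z) =
      (\<Sum>z | poly P z = 0. if z \<in> inside (path_image \<gamma>) then of_nat (Polynomial.order z P) else 0)"
    using wn by (intro sum.cong) auto
  also have "\<dots> = (\<Sum>z \<in> {z. poly P z = 0} \<inter> inside (path_image \<gamma>). of_nat (Polynomial.order z P))"
    using poly_roots_finite[OF P] by (simp add: sum.inter_restrict)
  also have "\<dots> = (\<Sum>z\<in>?I. of_nat (Polynomial.order z P))"
  proof (rule sum.mono_neutral_left)
    show "finite ?I" using poly_roots_finite[OF R] by (rule finite_subset[rotated]) auto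
  qed (use root order_root[of P] in auto)
  also have "\<dots> = of_int (\<Sum>z\<in>?I. int (Polynomial.order z P))" by simp
  finally show ?thesis using that[of g] g by simp
qed

context charges
begin

lemma monodromy_charges:
  assumes b_nz: "b \<noteq> 0" and D_nz: "D \<noteq> 0" and D: "D = a\<^sup>2 - 4 * b"
    and loop: "positive_simple_loop \<gamma>"
    and nz: "\<And>z. z \<in> path_image \<gamma> \<Longrightarrow> poly b z * poly D z \<noteq> 0"
    and basis: "continued_basis a b \<gamma> \<omega>1 \<omega>2"
  shows "\<exists>M. monodromy_matrix \<omega>1 \<omega>2 M \<and> M \<in> carrier Gamma0_2 \<and>
    QZ M = (\<Sum>z | z \<in> inside (path_image \<gamma>) \<and> poly b z * poly D z = 0.
              int (Polynomial.order z D) - int (Polynomial.order z b)) \<and>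
    QZ4 M = (- (\<Sum>z | z \<in> inside (path_image \<gamma>) \<and> poly b z * poly D z = 0.
              int (Polynomial.order z b))) mod 4"
proof -
  define \<tau> where "\<tau> t = \<omega>2 t / \<omega>1 t" for t
  have cont: "continuous_on {0..1} \<omega>1" "continuous_on {0..1} \<omega>2"
    and adm: "\<And>t. t \<in> {0..1} \<Longrightarrow> admissible_basis (poly a (\<gamma> t)) (poly b (\<gamma> t)) (\<omega>1 t) (\<omega>2 t)"
    using basis by (auto simp: continued_basis_def)
  have \<tau>: "Im (\<tau> t) > 0" and pb: "period_basis (\<omega>1 t) (\<omega>2 t)" if "t \<in> {0..1}" for t
    using adm[OF that] by (auto simp: admissible_basis_def \<tau>_def period_basis_def)
  have \<omega>1_nz: "\<omega>1 t \<noteq> 0" if "t \<in> {0..1}" for t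
    using period_basis.w1_nz[OF pb[OF that]] .
  have cont\<tau>: "continuous_on {0..1} \<tau>"
    unfolding \<tau>_def using \<omega>1_nz by (intro continuous_intros cont) auto
  have nzt: "poly b (\<gamma> t) \<noteq> 0" "poly D (\<gamma> t) \<noteq> 0" if "t \<in> {0..1}" for t
    using nz[of "\<gamma> t"] that by (auto simp: path_image_def)
  have closed: "\<gamma> 1 = \<gamma> 0"
    using loop by (auto simp: positive_simple_loop_def pathfinish_def pathstart_def)
  let ?I = "{z. z \<in> inside (path_image \<gamma>) \<and> poly b z * poly D z = 0}"
  define Nb ND where "Nb = (\<Sum>z\<in>?I. int (Polynomial.order z b))"
    and "ND = (\<Sum>z\<in>?I. int (Polynomial.order z D))"
  have R: "b * D \<noteq> 0" using b_nz D_nz by simp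
  obtain gb where gb: "continuous_on {0..1} gb" "\<And>t. t \<in> {0..1} \<Longrightarrow> exp (gb t) = poly b (\<gamma> t)"
    "gb 1 - gb 0 = 2 * of_real pi * \<i> * of_int Nb"
    using poly_continuous_log_simple_loop[of b "b * D" \<gamma>] R loop nz by (auto simp: Nb_def)
  obtain gD where gD: "continuous_on {0..1} gD" "\<And>t. t \<in> {0..1} \<Longrightarrow> exp (gD t) = poly D (\<gamma> t)"
    "gD 1 - gD 0 = 2 * of_real pi * \<i> * of_int ND"
    using poly_continuous_log_simple_loop[of D "b * D" \<gamma>] R loop nz by (auto simp: ND_def)

  \<comment> \<open>A continuous logarithm of 256 times the first quotient times b/D, up to the
    constant 256; being constant, it equates the increment of \<open>log24\<close> with those of log
    D and log b.\<close>
  have "exp (log24 (\<tau> t) - (gD t - gb t)) = 1 / 2 ^ 8" if t: "t \<in> {0..1}" for t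
  proof -
    have "exp (log24 (\<tau> t)) = poly D (\<gamma> t) / (2 ^ 8 * poly b (\<gamma> t))"
      using exp_log_quotients(1)[OF \<tau>[OF t]] eta_quotients_admissible(1)[OF nzt(1)[OF t] adm[OF t]]
      by (simp add: \<tau>_def D)
    then show ?thesis using nzt[OF t] by (simp add: exp_diff gD(2)[OF t] gb(2)[OF t])
  qed
  moreover have cl: "continuous_on {0..1} (\<lambda>t. log24 (\<tau> t))" "continuous_on {0..1} (\<lambda>t. log8 (\<tau> t))"
    by (rule continuous_on_compose2[OF continuous_on_logs(1) cont\<tau>] continuous_on_compose2[OF continuous_on_logs(2) cont\<tau>];
        use \<tau> in blast)+
  ultimately have "log24 (\<tau> 1) - (gD 1 - gb 1) = log24 (\<tau> 0) - (gD 0 - gb 0)"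
    by (intro continuous_exp_const[of "{0..1::real}" "\<lambda>t. log24 (\<tau> t) - (gD t - gb t)" "1 / 2 ^ 8"] continuous_intros gD(1) gb(1)) auto
  then have "log24 (\<tau> 1) - log24 (\<tau> 0) = (gD 1 - gD 0) - (gb 1 - gb 0)" by (simp add: algebra_simps)
  then have log24_change: "log24 (\<tau> 1) - log24 (\<tau> 0) = 2 * of_real pi * \<i> * of_int (ND - Nb)"
    unfolding gD(3) gb(3) by (simp add: algebra_simps)

  \<comment> \<open>The product of \<omega>1, the fourth root of the second quotient and a
    continuous fourth root of b: its fourth power is constant, hence so is the product
    itself.\<close>
  have "(\<omega>1 t * exp (log8 (\<tau> t)) * exp (gb t / 4)) ^ 4 = (2 * of_real pi) ^ 4" if t: "t \<in> {0..1}" for t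
  proof -
    have e4: "exp (log8 (\<tau> t)) ^ 4 = exp (4 * log8 (\<tau> t))" "exp (gb t / 4) ^ 4 = poly b (\<gamma> t)"
      unfolding gb(2)[OF t, symmetric] by (simp_all flip: exp_of_nat_mult)
    have "exp (4 * log8 (\<tau> t)) = (2 * of_real pi / \<omega>1 t) ^ 4 * (1 / poly b (\<gamma> t))"
      using exp_log_quotients(2)[OF \<tau>[OF t]] eta_quotients_admissible(2)[OF nzt(1)[OF t] adm[OF t]]
      by (simp add: \<tau>_def)
    then show ?thesis
      unfolding power_mult_distrib e4 using nzt[OF t] \<omega>1_nz[OF t] by (simp add: power_divide)
  qed
  then have W: "\<omega>1 1 * exp (log8 (\<tau> 1)) * exp (gb 1 / 4) = \<omega>1 0 * exp (log8 (\<tau> 0)) * exp (gb 0 / 4)"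
    by (intro continuous_fourth_power_const[of "{0..1::real}" "\<lambda>t. \<omega>1 t * exp (log8 (\<tau> t)) * exp (gb t / 4)" "(2 * of_real pi) ^ 4"]
          continuous_intros cont cl gb(1)) auto

  define L where "L = period_lattice (poly a (\<gamma> 0)) (poly b (\<gamma> 0))"
  obtain \<phi> where \<phi>: "uniformization (poly a (\<gamma> 0)) (poly b (\<gamma> 0)) \<phi>" "\<phi> (\<omega>1 0 / 2) = (0, 0)"
    and L0: "L = lattice (\<omega>1 0) (\<omega>2 0)"
    using adm[of 0] by (auto simp: admissible_basis_def L_def lattice_def)
  obtain \<psi> where \<psi>: "uniformization (poly a (\<gamma> 0)) (poly b (\<gamma> 0)) \<psi>" "\<psi> (\<omega>1 1 / 2) = (0, 0)"
    and L1: "L = lattice (\<omega>1 1) (\<omega>2 1)"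
    using adm[of 1] by (auto simp: admissible_basis_def L_def lattice_def closed)
  interpret Z: period_basis "\<omega>1 0" "\<omega>2 0" by (rule pb) simp
  interpret O: period_basis "\<omega>1 1" "\<omega>2 1" by (rule pb) simp
  obtain p q r s where M: "\<omega>2 1 = of_int p * \<omega>2 0 + of_int q * \<omega>1 0" "\<omega>1 1 = of_int r * \<omega>2 0 + of_int s * \<omega>1 0"
    "p * s - q * r = 1"
    using Z.change_of_basis[OF O.period_basis_axioms] L0 L1 by metis
  \<comment> \<open>Both half periods go to (0,0) under uniformizations of the same curve, the loop
    being closed. The coefficient of the second period in their difference is r/2, so integrality of
    it means that r is even.\<close>
  have "\<omega>1 1 / 2 - \<omega>1 0 / 2 \<in> lattice (\<omega>1 0) (\<omega>2 0)"
  proof (rule Z.uniformization_unique[OF \<phi>(1) \<psi>(1) _ _ \<phi>(2) _ _ \<psi>(2)])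
    show "\<omega>1 1 / 2 \<notin> lattice (\<omega>1 0) (\<omega>2 0)" "2 * (\<omega>1 1 / 2) \<in> lattice (\<omega>1 0) (\<omega>2 0)"
      using O.half_periods_notin(1) O.periods_in_lattice(1) L0 L1 by simp_all
  qed (use L0 L_def nzt in auto)
  moreover have "\<omega>1 1 / 2 - \<omega>1 0 / 2 = of_real (of_int (s - 1) / 2) * \<omega>1 0 + of_real (of_int r / 2) * \<omega>2 0"
    unfolding M(2) by (simp add: field_simps)
  ultimately have "(of_int r / 2 :: real) \<in> \<int>" using Z.comb_in_lattice_iff by metis
  then obtain n where "of_int r / 2 = (of_int n :: real)" by (auto elim: Ints_cases)
  then have "(of_int r :: real) = of_int (2 * n)" by simp
  then have even: "even r" by (metis dvd_triv_left of_int_eq_iff)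

  have t0: "Im (\<tau> 0) > 0" using \<tau> by simp
  define d where "d = of_int r * \<tau> 0 + of_int s"
  have \<omega>11: "\<omega>1 1 = d * \<omega>1 0" unfolding M(2) using Z.w1_nz by (simp add: d_def \<tau>_def algebra_simps)
  have \<omega>21: "\<omega>2 1 = (of_int p * \<tau> 0 + of_int q) * \<omega>1 0"
    unfolding M(1) using Z.w1_nz by (simp add: \<tau>_def algebra_simps)
  have \<tau>1: "\<tau> 1 = (of_int p * \<tau> 0 + of_int q) / (of_int r * \<tau> 0 + of_int s)"
    unfolding \<tau>_def[of 1] \<omega>11 \<omega>21 using Z.w1_nz by (simp add: d_def)
  note tr = log_transformation[OF M(3) even t0, folded \<tau>1 d_def]
  let ?M = "mat2 p q r s"
  have c: "?M \<in> carrier Gamma0_2" using M(3) even by (simp add: mat2_carrier)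
  have "2 * of_real pi * \<i> * of_int (QZ ?M) = 2 * of_real pi * \<i> * of_int (ND - Nb)"
    using tr(1) log24_change by simp
  then have QZ: "QZ ?M = ND - Nb"
  proof -
    have "2 * of_real pi * \<i> \<noteq> (0 :: complex)" by simp
    with \<open>2 * of_real pi * \<i> * of_int (QZ ?M) = 2 * of_real pi * \<i> * of_int (ND - Nb)\<close>
    have "(of_int (QZ ?M) :: complex) = of_int (ND - Nb)" using mult_left_cancel by blast
    then show ?thesis by (simp only: of_int_eq_iff)
  qed
  \<comment> \<open>Around the loop the fourth root of b gains i^Nb, and \<omega>1 times the root of
    the quotient gains i to the charge. Their product is unchanged, which explains the minus sign in
    the formula for the charge.\<close>
  have "i_pow (QZ4 ?M + Nb) = 1"
  proof -
    have "gb 1 / 4 = gb 0 / 4 + of_int Nb * (2 * of_real pi * \<i> / 4)"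
      using gb(3) by (simp add: field_simps)
    then have E: "exp (gb 1 / 4) = exp (gb 0 / 4) * i_pow Nb" by (simp only: i_pow_def exp_add)
    have "\<omega>1 0 * (d * exp (log8 (\<tau> 1))) * (exp (gb 0 / 4) * i_pow Nb) = \<omega>1 0 * exp (log8 (\<tau> 0)) * exp (gb 0 / 4)"
      using W unfolding \<omega>11 E by (simp add: mult_ac)
    then have "(\<omega>1 0 * exp (log8 (\<tau> 0)) * exp (gb 0 / 4)) * i_pow (QZ4 ?M + Nb) =
        (\<omega>1 0 * exp (log8 (\<tau> 0)) * exp (gb 0 / 4)) * 1"
      unfolding tr(2) i_pow_add by (simp add: mult_ac)
    moreover have "\<omega>1 0 * exp (log8 (\<tau> 0)) * exp (gb 0 / 4) \<noteq> 0" using Z.w1_nz by simp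
    ultimately show ?thesis using mult_left_cancel by blast
  qed
  then have "4 dvd QZ4 ?M + Nb" by (simp add: i_pow_eq_1_iff)
  \<comment> \<open>Divisibility fixes the charge modulo 4 only; the range 0 to 3 selects the
    representative.\<close>
  then have QZ4: "QZ4 ?M = (- Nb) mod 4" using QZ4_range[OF c] by presburger
  have "monodromy_matrix \<omega>1 \<omega>2 ?M" unfolding monodromy_matrix_def mat2_nth using M(1,2) by blast
  then show ?thesis using c QZ QZ4 unfolding Nb_def ND_def by (auto simp: sum_subtractf)
qed

end

theorem mainTheorem3:
  fixes a b D :: "complex poly"
    and QZ QZ4 :: "int ^ 2 ^ 2 \<Rightarrow> int"
  assumes deg_a: "degree a = 4"
    and deg_b: "degree b = 8"
    and D: "D = a\<^sup>2 - 4 * b"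
    and b_nz: "b \<noteq> 0"
    and D_nz: "D \<noteq> 0"
    and QZ_hom: "QZ \<in> hom Gamma0_2 integer_group"
    and QZ_T: "QZ mat_T = 1"
    and QZ_X: "QZ mat_X = 0"
    and QZ4_hom: "QZ4 \<in> hom Gamma0_2 (integer_mod_group 4)"
    and QZ4_T: "QZ4 mat_T = 0"
    and QZ4_X: "QZ4 mat_X = 1"
  shows "(\<forall>z \<omega>\<^sub>1 \<omega>\<^sub>2 \<tau>.
            poly b z * poly D z \<noteq> 0 \<longrightarrow>
            admissible_basis (poly a z) (poly b z) \<omega>\<^sub>1 \<omega>\<^sub>2 \<longrightarrow>
            \<tau> = \<omega>\<^sub>2 / \<omega>\<^sub>1 \<longrightarrow>
              dedekind_eta (2 * \<tau>) ^ 24 / dedekind_eta \<tau> ^ 24 = poly D z / (2 ^ 8 * poly b z) \<and>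
              dedekind_eta (2 * \<tau>) ^ 8 / dedekind_eta \<tau> ^ 16 =
                (2 * of_real pi / \<omega>\<^sub>1) ^ 4 * (1 / poly b z)) \<and>
         (\<forall>\<gamma> \<omega>\<^sub>1 \<omega>\<^sub>2.
            positive_simple_loop \<gamma> \<longrightarrow>
            (\<forall>z\<in>path_image \<gamma>. poly b z * poly D z \<noteq> 0) \<longrightarrow>
            continued_basis a b \<gamma> \<omega>\<^sub>1 \<omega>\<^sub>2 \<longrightarrow>
            (\<exists>M. monodromy_matrix \<omega>\<^sub>1 \<omega>\<^sub>2 M \<and>
               M \<in> carrier Gamma0_2 \<and>
               QZ M = (\<Sum>z | z \<in> inside (path_image \<gamma>) \<and> poly b z * poly D z = 0.
                         int (Polynomial.order z D) - int (Polynomial.order z b)) \<and>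
               QZ4 M = (- (\<Sum>z | z \<in> inside (path_image \<gamma>) \<and> poly b z * poly D z = 0.
                              int (Polynomial.order z b))) mod 4))"
proof (intro conjI allI impI)
  fix z \<omega>1 \<omega>2 \<tau>
  assume nz: "poly b z * poly D z \<noteq> 0" and adm: "admissible_basis (poly a z) (poly b z) \<omega>1 \<omega>2"
    and \<tau>: "\<tau> = \<omega>2 / \<omega>1"
  have b: "poly b z \<noteq> 0" using nz by simp
  show "dedekind_eta (2 * \<tau>) ^ 24 / dedekind_eta \<tau> ^ 24 = poly D z / (2 ^ 8 * poly b z)"
    using eta_quotients_admissible(1)[OF b adm] by (simp add: \<tau> D)
  show "dedekind_eta (2 * \<tau>) ^ 8 / dedekind_eta \<tau> ^ 16 = (2 * of_real pi / \<omega>1) ^ 4 * (1 / poly b z)"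
    using eta_quotients_admissible(2)[OF b adm] by (simp only: \<tau>)
next
  fix \<gamma> \<omega>1 \<omega>2
  interpret charges QZ QZ4
    by unfold_locales (fact QZ_hom QZ_T QZ_X QZ4_hom QZ4_T QZ4_X)+
  assume "positive_simple_loop \<gamma>" "\<forall>z\<in>path_image \<gamma>. poly b z * poly D z \<noteq> 0" "continued_basis a b \<gamma> \<omega>1 \<omega>2"
  then show "\<exists>M. monodromy_matrix \<omega>1 \<omega>2 M \<and>
               M \<in> carrier Gamma0_2 \<and>
               QZ M = (\<Sum>z | z \<in> inside (path_image \<gamma>) \<and> poly b z * poly D z = 0.
                         int (Polynomial.order z D) - int (Polynomial.order z b)) \<and>
               QZ4 M = (- (\<Sum>z | z \<in> inside (path_image \<gamma>) \<and> poly b z * poly D z = 0.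
                              int (Polynomial.order z b))) mod 4"
    by (intro monodromy_charges[OF b_nz D_nz D]) auto
qed

end
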